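(* Let $(W,Y)$ and $(W',Y')$ be random vectors on a common probability space satisfying the following. (I) $\mathbb{E}W=0$, $\operatorname{Var}(W)=1$; $\mathbb{E}Y=0$, $\operatorname{Var}(Y)=\sigma_Y^2$; $W$ and $Y$ are uncorrelated; and $(W,Y,W',Y')\overset{d}{=}(W',Y',W,Y)$. (II) $Y$ takes values in $\zeta+\mathbb{Z}$ for some $\zeta\in[0,1)$, $\Delta Y:=Y'-Y\in\{-1,0,1\}$ almost surely, and $M_{0,\pm}(W,Y)=Q+R_{0,\pm}$, where $Q=\lambda\sigma_Y^2$ for some $\lambda\in(0,1)$ and $R_{0,\pm}$ are random variables. (III) $M_{1,\pm}(W,Y)=-\lambda\left(\tfrac12\psi W+R_{1,\pm}\right)$ for some $\psi>0$ and random variables $R_{1,\pm}$. (IV) $M_{2,\pm}(W,Y)=\lambda(\psi+R_{2,\pm})$ for random variables $R_{2,\pm}$. Let $k$ be such that $p_k:=\mathbb{P}(Y=k)>0$ and $p_{k-1}:=\mathbb{P}(Y=k-1)>0$, and let $r_k:=p_{k-1}/p_k$. Then, with $Z$ standard normal, $$d_W\big((W\mid Y=k),Z\big)\le\frac1\psi\widehat A_k+\sqrt{\frac{1}{2\pi\psi^2}}\widehat B_k+(1+r_k)\Big(\frac{1}{2Q}\widehat C_k+\frac1{2Q}\widehat D_k+\frac{2}{3\lambda\psi}\widehat E_k\Big),$$ where $\widehat A_k=\mathbb{E}(|R_{1,-}|\mid Y=k)+r_k\,\mathbb{E}(|R_{1,+}|\mid Y=k-1)$, $\widehat B_k=\mathbb{E}(|R_{2,-}|\mid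 Y=k)+r_k\,\mathbb{E}(|R_{2,+}|\mid Y=k-1)$, $\widehat C_k=\mathbb{E}\big((|W|+\mathbb{E}|Z|)(|R_{0,+}|+|R_{0,-}|)\mid Y\in\{k-1,k\}\big)$, $\widehat D_k=\mathbb{E}(|\Delta W|\mid Y\in\{k-1,k\})$, $\widehat E_k=\mathbb{E}(|\Delta W|^3\mid Y\in\{k-1,k\})$.
   Context: $\Delta W:=W'-W$. For $\ell\ge0$, $M_{\ell,\pm}(W,Y):=\mathbb{E}\big((\Delta W)^\ell\,\mathbf{1}_{\{\Delta Y=\pm1\}}\mid W,Y\big)$. For a random variable $V$ and event $B$ of positive probability, $d_W((V\mid B),Z):=\sup_h|\mathbb{E}(h(V)\mid B)-\mathbb{E}h(Z)|$ over all $1$-Lipschitz $h:\mathbb{R}\to\mathbb{R}$. *)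

theory Defs
  imports "HOL-Probability.Probability"
begin

definition sigma_pair :: "'a measure \<Rightarrow> ('a \<Rightarrow> real) \<Rightarrow> ('a \<Rightarrow> real) \<Rightarrow> 'a measure" where
  "sigma_pair M W Y = vimage_algebra (space M) (\<lambda>x. (W x, Y x)) borel"

definition cond_nn :: "'a measure \<Rightarrow> ('a \<Rightarrow> real) \<Rightarrow> 'a set \<Rightarrow> ennreal" where
  "cond_nn M f B = (\<integral>\<^sup>+x. ennreal (f x) * indicator B x \<partial>M) / emeasure M B"

definition cond_ev :: "'a measure \<Rightarrow> ('a \<Rightarrow> real) \<Rightarrow> 'a set \<Rightarrow> real" where
  "cond_ev M f B = (\<integral>x. f x * indicator B x \<partial>M) / measure M B"

definition std_normal_exp :: "(real \<Rightarrow> real) \<Rightarrow> real" where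
  "std_normal_exp h = (\<integral>x. h x \<partial>(density lborel std_normal_density))"

definition dW_cond :: "'a measure \<Rightarrow> ('a \<Rightarrow> real) \<Rightarrow> 'a set \<Rightarrow> ennreal" where
  "dW_cond M V B = (SUP h \<in> {h :: real \<Rightarrow> real. 1-lipschitz_on UNIV h}.
      ennreal \<bar>cond_ev M (\<lambda>x. h (V x)) B - std_normal_exp h\<bar>)"

end

theory Submission
  imports Defs "HOL-Real_Asymp.Real_Asymp"
begin

text \<open>
  Let \<open>f\<close> solve Stein's equation \<open>f' w - w f w = h w - \<E> h(Z)\<close> for a 1-Lipschitz \<open>h\<close>; it satisfies
  \<open>\<bar>f\<bar> \<le> 1\<close> and \<open>\<bar>f'\<bar> \<le> sqrt (2 / \<pi>)\<close>, and \<open>f'\<close> is 2-Lipschitz. By exchangeability the antisymmetric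
  quantity \<open>(W' - W) (f W + f W')\<close> has expectation zero on the event that the pair \<open>(Y, Y')\<close> crosses
  between \<open>k\<close> and \<open>k - 1\<close> in either direction. Expanding \<open>f W'\<close> around \<open>W\<close> and conditioning on \<open>(W, Y)\<close>
  controls the sum of \<open>\<E> (h W - \<E> h(Z)) 1{Y = c}\<close> over \<open>c \<in> {k - 1, k}\<close>. Comparing the crossings
  \<open>k \<rightarrow> k - 1\<close> and \<open>k - 1 \<rightarrow> k\<close> controls the difference of these two expectations, hence each of them.
\<close>

section \<open>Gaussian partial moments\<close>

text \<open>Antisymmetry needs an event that is invariant under the swap, so both crossing
  directions have to be counted together. The second-order identity therefore sees only the sum over
  the levels \<open>k\<close> and \<open>k - 1\<close>, and a first-order balance is needed to
  separate them; this balance is what brings \<open>Q\<close> into the bound. Recovering one number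
  from its sum and difference with another is the origin of the halved constants such as
  \<open>1 / (2 * Q)\<close>. As \<open>h\<close> is only Lipschitz, \<open>f'\<close> need not be
  differentiable, and a Lipschitz bound on \<open>f'\<close> replaces a bound on a second
  derivative. The constant \<open>sqrt (2 / pi)\<close> is the mean of the absolute value of Z and
  cannot be improved: for \<open>h = abs\<close> Stein's equation at 0 gives
  \<open>f' 0 = - std_normal_exp abs\<close>. This sharp value is the hard analytic point. It rests
  on an inequality for a product of two Gaussian partial expectations that is an equality at 0. Of
  all the quantities on the right only the third absolute moment of \<open>W' - W\<close> can be
  infinite.\<close>

lemma LINT_atMost_tendsto_0:
  fixes g :: "real \<Rightarrow> real"
  assumes "integrable lborel g"
  shows "((\<lambda>w. LINT x:{..w}|lborel. g x) \<longlongrightarrow> 0) at_bot"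
proof -
  have "((\<lambda>w. LINT x|lborel. indicator {..- w} x *\<^sub>R g x) \<longlongrightarrow> (LINT (x::real)|lborel. (0::real))) at_top"
  proof (rule Bochner_Integration.integral_dominated_convergence_at_top[where w = "\<lambda>x. norm (g x)"
        and s = "\<lambda>w x. indicator {..- w} x *\<^sub>R g x" and f = "\<lambda>x. 0"])
    show "AE x in lborel. ((\<lambda>i. indicator {..- i} x *\<^sub>R g x) \<longlongrightarrow> 0) at_top"
    proof (rule AE_I2)
      fix x :: real
      have "\<forall>\<^sub>F i in at_top. indicator {..- i} x *\<^sub>R g x = 0"
        using eventually_gt_at_top[of "- x"] by eventually_elim (auto simp: indicator_def)
      then show "((\<lambda>i. indicator {..- i} x *\<^sub>R g x) \<longlongrightarrow> 0) at_top"
        by (rule tendsto_eventually)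
    qed
  qed (use assms in \<open>auto simp: indicator_def intro!: always_eventually\<close>)
  then show ?thesis
    unfolding at_bot_mirror filterlim_filtermap set_lebesgue_integral_def by simp
qed

text \<open>Near \<open>w\<close> the half-line integral is a constant plus an integral over a
  compact interval, to which the fundamental theorem of calculus applies.\<close>

lemma has_real_derivative_LINT_atMost:
  fixes g :: "real \<Rightarrow> real"
  assumes int: "integrable lborel g" and cont: "continuous_on UNIV g"
  shows "((\<lambda>w. LINT x:{..w}|lborel. g x) has_real_derivative g w) (at w)"
proof -
  \<comment> \<open>The base point lies strictly left of \<open>w\<close>, so
    \<open>{a..w + 1}\<close> is a neighbourhood of \<open>w\<close> and the derivative within it is
    the full derivative.\<close>
  define a where "a = w - 1"
  have int': "set_integrable lborel S g" if "S \<in> sets lborel" for S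
    using that int set_integrable_subset[of lborel UNIV g S] by (auto simp: set_integrable_def)
  have split: "(LINT x:{..v}|lborel. g x) = (LINT x:{..a}|lborel. g x) + integral {a..v} g"
    if "v \<in> {a..w + 1}" for v
  proof -
    have "{..v} = {..a} \<union> {a<..v}"
      using that by auto
    then have "(LINT x:{..v}|lborel. g x) = (LINT x:{..a}|lborel. g x) + (LINT x:{a<..v}|lborel. g x)"
      by (simp add: set_integral_Un int' disjoint_iff)
    also have "(LINT x:{a<..v}|lborel. g x) = integral {a<..v} g"
      by (intro set_borel_integral_eq_integral int') auto
    also have "\<dots> = integral {a..v} g"
      by (rule integral_subset_negligible) (auto intro: negligible_subset[of "{a}"])
    finally show ?thesis .
  qed
  have "((\<lambda>v. integral {a..v} g) has_real_derivative g w) (at w within {a..w + 1})"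
    by (rule integral_has_real_derivative) (auto simp: a_def intro: continuous_on_subset[OF cont])
  then have "((\<lambda>v. (LINT x:{..a}|lborel. g x) + integral {a..v} g) has_real_derivative g w) (at w within {a..w + 1})"
    by (auto intro!: derivative_eq_intros)
  then have "((\<lambda>v. LINT x:{..v}|lborel. g x) has_real_derivative g w) (at w within {a..w + 1})"
    by (rule has_field_derivative_transform_within[where d = 1, OF _ _ _ split[symmetric]])
       (auto simp: a_def)
  moreover have "at w within {a..w + 1} = at w"
    by (rule at_within_interior) (auto simp: a_def)
  ultimately show ?thesis by simp
qed

text \<open>The difference of the two sides has derivative 0 and tends to 0 at minus infinity. A
  closed form of a partial moment is thus verified by differentiating the candidate.\<close>

lemma LINT_atMost_eq_antiderivative:
  fixes g G :: "real \<Rightarrow> real"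
  assumes int: "integrable lborel g" and cont: "continuous_on UNIV g"
    and deriv: "\<And>x. (G has_real_derivative g x) (at x)" and lim: "(G \<longlongrightarrow> 0) at_bot"
  shows "(LINT x:{..w}|lborel. g x) = G w"
proof -
  define H where "H w = (LINT x:{..w}|lborel. g x) - G w" for w
  have "(H has_real_derivative 0) (at x)" for x
    unfolding H_def
    by (rule DERIV_cong[OF DERIV_diff[OF has_real_derivative_LINT_atMost[OF int cont] deriv]]) simp
  then have const: "H x = H w" for x
    using DERIV_isconst_all by blast
  have "(H \<longlongrightarrow> 0 - 0) at_bot"
    unfolding H_def by (intro tendsto_diff LINT_atMost_tendsto_0 int lim)
  moreover have "(H \<longlongrightarrow> H w) at_bot"
    using const by (intro tendsto_eventually always_eventually) auto
  ultimately have "H w = 0"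
    by (metis tendsto_unique trivial_limit_at_bot_linorder diff_zero)
  then show ?thesis by (simp add: H_def)
qed

section \<open>The standard normal density and distribution function\<close>

abbreviation (input) phi :: "real \<Rightarrow> real" where
  "phi \<equiv> std_normal_density"

definition std_normal_cdf :: "real \<Rightarrow> real" where
  "std_normal_cdf w = (LINT x:{..w}|lborel. phi x)"

lemma DERIV_phi: "(phi has_real_derivative - w * phi w) (at w)"
  unfolding std_normal_density_def
  by (auto intro!: derivative_eq_intros simp: field_simps)

lemma continuous_phi [continuous_intros]: "continuous_on A phi"
  using DERIV_phi DERIV_isCont continuous_at_imp_continuous_on by blast

lemma phi_pos: "phi w > 0"
  by (simp add: std_normal_density_def)

lemma integrable_phi: "integrable lborel phi"
  using integrable_std_normal_moment[of 0] by simp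

lemma integrable_phi_x: "integrable lborel (\<lambda>x. x * phi x)"
  using integrable_std_normal_moment[of 1] by (simp add: mult.commute)

lemma integrable_phi_x2: "integrable lborel (\<lambda>x. x\<^sup>2 * phi x)"
  using integrable_std_normal_moment[of 2] by (simp add: mult.commute)

lemma DERIV_std_normal_cdf: "(std_normal_cdf has_real_derivative phi w) (at w)"
  unfolding std_normal_cdf_def[abs_def]
  by (intro has_real_derivative_LINT_atMost integrable_phi continuous_intros)

lemma std_normal_cdf_at_bot: "(std_normal_cdf \<longlongrightarrow> 0) at_bot"
  unfolding std_normal_cdf_def[abs_def] by (intro LINT_atMost_tendsto_0 integrable_phi)

lemma LINT_atMost_x: "(LINT x:{..w}|lborel. x * phi x) = - phi w"
proof (rule LINT_atMost_eq_antiderivative[OF integrable_phi_x])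
  show "((\<lambda>x. - phi x) \<longlongrightarrow> 0) at_bot"
    unfolding std_normal_density_def by real_asymp
qed (auto intro!: continuous_intros derivative_eq_intros DERIV_phi)

lemma LINT_atMost_x2: "(LINT x:{..w}|lborel. x\<^sup>2 * phi x) = std_normal_cdf w - w * phi w"
proof (rule LINT_atMost_eq_antiderivative[OF integrable_phi_x2])
  have "((\<lambda>x. x * phi x) \<longlongrightarrow> 0) at_bot"
    unfolding std_normal_density_def by real_asymp
  from tendsto_diff[OF std_normal_cdf_at_bot this]
  show "((\<lambda>x. std_normal_cdf x - x * phi x) \<longlongrightarrow> 0) at_bot" by simp
qed (auto intro!: continuous_intros derivative_eq_intros DERIV_phi DERIV_std_normal_cdf
     simp: power2_eq_square algebra_simps)

lemma integral_phi: "(LINT x|lborel. phi x) = 1"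
  using integral_std_normal_moment_even[of 0] by simp

lemma integral_phi_x: "(LINT x|lborel. x * phi x) = 0"
  using integral_std_normal_moment_odd[of 0] by (simp add: mult.commute)

lemma std_normal_cdf_at_top: "(std_normal_cdf \<longlongrightarrow> 1) at_top"
  using tendsto_integral_at_top[of lborel phi] integrable_phi
  by (simp add: std_normal_cdf_def[abs_def] set_lebesgue_integral_def integral_phi)

lemma phi_minus: "phi (- w) = phi w"
  by (simp add: std_normal_density_def)

text \<open>As \<open>phi\<close> is even, \<open>K\<close> below has derivative 0, and its limit at
  infinity fixes the constant 1. This reflection carries every lower tail estimate over to the upper
  tail.\<close>

lemma std_normal_cdf_minus: "std_normal_cdf (- w) = 1 - std_normal_cdf w"
proof -
  define K where "K w = std_normal_cdf w + std_normal_cdf (- w)" for w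
  have "(K has_real_derivative 0) (at x)" for x
    unfolding K_def
    by (auto intro!: derivative_eq_intros DERIV_std_normal_cdf
        DERIV_chain'[where f = uminus and g = std_normal_cdf] simp: phi_minus)
  then have const: "K x = K w" for x
    using DERIV_isconst_all by blast
  have "(K \<longlongrightarrow> 1 + 0) at_top"
    unfolding K_def
    by (intro tendsto_add std_normal_cdf_at_top
        filterlim_compose[OF std_normal_cdf_at_bot filterlim_uminus_at_bot_at_top])
  moreover have "(K \<longlongrightarrow> K w) at_top"
    using const by (intro tendsto_eventually always_eventually) auto
  ultimately have "K w = 1"
    by (metis tendsto_unique trivial_limit_at_top_linorder add_0_right)
  then show ?thesis by (simp add: K_def)
qed

lemma std_normal_cdf_nonneg: "0 \<le> std_normal_cdf w"
  unfolding std_normal_cdf_def set_lebesgue_integral_def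
  by (intro Bochner_Integration.integral_nonneg) auto

lemma std_normal_cdf_le_1: "std_normal_cdf w \<le> 1"
  using std_normal_cdf_nonneg[of "- w"] by (simp add: std_normal_cdf_minus)

section \<open>Partial moments of the two tails and the Mills ratio\<close>

lemma LINT_atMost_diff:
  "(LINT x:{..w}|lborel. (w - x) * phi x) = w * std_normal_cdf w + phi w"
proof -
  have int: "set_integrable lborel {..w} g" if "integrable lborel g" for g :: "real \<Rightarrow> real"
    using that set_integrable_subset[of lborel UNIV g "{..w}"] by (auto simp: set_integrable_def)
  have "(LINT x:{..w}|lborel. (w - x) * phi x) = (LINT x:{..w}|lborel. w * phi x - x * phi x)"
    by (simp add: algebra_simps)
  also have "\<dots> = w * (LINT x:{..w}|lborel. phi x) - (LINT x:{..w}|lborel. x * phi x)"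
    by (subst set_integral_diff) (auto intro!: int integrable_phi integrable_phi_x)
  finally show ?thesis
    by (simp add: std_normal_cdf_def LINT_atMost_x)
qed

text \<open>The right-hand side is the mean of the positive part of \<open>w - Z\<close>.\<close>

lemma lower_partial_expectation_nonneg: "0 \<le> phi w + w * std_normal_cdf w"
proof -
  have "0 \<le> (LINT x:{..w}|lborel. (w - x) * phi x)"
    unfolding set_lebesgue_integral_def
    by (intro Bochner_Integration.integral_nonneg) (auto simp: indicator_def)
  then show ?thesis by (simp add: LINT_atMost_diff)
qed

text \<open>By reflection this is the mean of the positive part of \<open>Z - w\<close>. For
  \<open>w > 0\<close> it is the upper Mills bound
  \<open>1 - std_normal_cdf w \<le> phi w / w\<close>.\<close>

lemma upper_partial_expectation_nonneg: "0 \<le> phi w + w * std_normal_cdf w - w"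
  using lower_partial_expectation_nonneg[of "- w"]
  by (simp add: phi_minus std_normal_cdf_minus algebra_simps)

text \<open>The right-hand side is the second moment of the positive part of
  \<open>w - Z\<close>.\<close>

lemma lower_partial_variance_nonneg: "0 \<le> (1 + w\<^sup>2) * std_normal_cdf w + w * phi w"
proof -
  have int: "set_integrable lborel {..w} g" if "integrable lborel g" for g :: "real \<Rightarrow> real"
    using that set_integrable_subset[of lborel UNIV g "{..w}"] by (auto simp: set_integrable_def)
  have "0 \<le> (LINT x:{..w}|lborel. (w - x)\<^sup>2 * phi x)"
    unfolding set_lebesgue_integral_def
    by (intro Bochner_Integration.integral_nonneg) (auto simp: indicator_def)
  also have "\<dots> = (LINT x:{..w}|lborel. (w\<^sup>2 * phi x - 2 * w * (x * phi x)) + x\<^sup>2 * phi x)"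
    by (simp add: power2_eq_square algebra_simps)
  also have "\<dots> = (LINT x:{..w}|lborel. w\<^sup>2 * phi x - 2 * w * (x * phi x))
      + (LINT x:{..w}|lborel. x\<^sup>2 * phi x)"
    by (intro set_integral_add(2) int Bochner_Integration.integrable_diff integrable_mult_right
        integrable_phi integrable_phi_x integrable_phi_x2)
  also have "(LINT x:{..w}|lborel. w\<^sup>2 * phi x - 2 * w * (x * phi x)) =
      (LINT x:{..w}|lborel. w\<^sup>2 * phi x) - (LINT x:{..w}|lborel. 2 * w * (x * phi x))"
    by (intro set_integral_diff(2) int integrable_mult_right integrable_phi integrable_phi_x)
  also have "(LINT x:{..w}|lborel. w\<^sup>2 * phi x) = w\<^sup>2 * std_normal_cdf w"
    by (simp add: std_normal_cdf_def)
  also have "(LINT x:{..w}|lborel. 2 * w * (x * phi x)) = 2 * w * - phi w"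
    unfolding set_integral_mult_right LINT_atMost_x ..
  finally show ?thesis
    unfolding LINT_atMost_x2 by (simp add: algebra_simps)
qed

text \<open>This is the second moment of the positive part of \<open>Z - w\<close>, and at the same
  time the lower Mills bound. Both partial second moments return as the weights in the estimate of
  the derivative of \<open>w * f w\<close>.\<close>

lemma upper_partial_variance_nonneg: "0 \<le> (1 + w\<^sup>2) * (1 - std_normal_cdf w) - w * phi w"
  using lower_partial_variance_nonneg[of "- w"]
  by (simp add: phi_minus std_normal_cdf_minus)

section \<open>A maximum principle and the product of the two partial expectations\<close>

lemma max_principle_half_line:
  fixes u u' u'' v :: "real \<Rightarrow> real"
  assumes zero: "u 0 \<le> 0"
    and deriv: "\<And>x. (u has_real_derivative u' x) (at x)"
    and deriv2: "\<And>x. (u' has_real_derivative u'' x) (at x)"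
    and convex: "\<And>x. 0 < x \<Longrightarrow> 0 < u x \<Longrightarrow> u' x = 0 \<Longrightarrow> 0 < u'' x"
    and le: "\<forall>\<^sub>F x in at_top. u x \<le> v x" and lim: "(v \<longlongrightarrow> 0) at_top"
    and w: "0 \<le> w"
  shows "u w \<le> 0"
proof (rule ccontr)
  assume "\<not> u w \<le> 0"
  then have pos: "0 < u w" by simp
  \<comment> \<open>Since \<open>u\<close> is eventually below a function that vanishes at infinity,
    it drops under \<open>u w\<close> at some \<open>N > w\<close>. Together with
    \<open>u 0 \<le> 0\<close> this forces the maximum over \<open>{0..N}\<close> into the
    interior.\<close>
  have "\<forall>\<^sub>F x in at_top. u x < u w \<and> w < x"
    using le order_tendstoD(2)[OF lim pos] eventually_gt_at_top[of w]
    by eventually_elim auto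
  then obtain N where N: "u N < u w" "w < N"
    using eventually_happens'[OF trivial_limit_at_top_linorder] by blast
  have "continuous_on {0..N} u"
    using deriv DERIV_isCont continuous_at_imp_continuous_on by blast
  then obtain z where z: "z \<in> {0..N}" and max: "\<And>y. y \<in> {0..N} \<Longrightarrow> u y \<le> u z"
    using continuous_attains_sup[of "{0..N}" u] w N by auto
  have "u w \<le> u z"
    using max[of w] w N by auto
  then have z0: "0 < z" "z < N" and uz: "0 < u z"
    using z zero N pos by (auto simp: less_le)
  have "u' z = 0"
    by (rule DERIV_local_max[OF deriv, of "min z (N - z)"]) (use z0 in \<open>auto intro!: max\<close>)
  \<comment> \<open>A critical point with positive second derivative cannot be a maximum:
    \<open>u'\<close> is positive just to the right of \<open>z\<close>, so \<open>u\<close>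
    increases there.\<close>
  with convex[OF z0(1) uz] have "0 < u'' z" by simp
  from DERIV_pos_inc_right[OF deriv2 this] \<open>u' z = 0\<close>
  obtain d where d: "d > 0" "\<And>h. h > 0 \<Longrightarrow> h < d \<Longrightarrow> 0 < u' (z + h)" by auto
  define h where "h = min (d / 2) (N - z)"
  have h: "0 < h" "h < d" "z + h \<le> N"
    using d z0 by (auto simp: h_def)
  obtain y where y: "z < y" "y < z + h" "u (z + h) - u z = (z + h - z) * u' y"
    using MVT2[of z "z + h" u u'] deriv h by auto
  have "0 < u' y"
    using d(2)[of "y - z"] y h by simp
  then have "u (z + h) > u z"
    using y h by (smt (verit) mult_pos_pos)
  then show False
    using max[of "z + h"] h z0 by auto
qed

text \<open>
  The functions below are \<open>P = \<Phi>(1 - \<Phi>)/\<phi>\<close> and \<open>D = (\<phi> + w\<Phi>)(\<phi> - w(1 - \<Phi>))/\<phi>\<close>. With \<open>q = P'\<close> and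
  \<open>d = D'\<close> one has \<open>q'' - w q' - 2 q = 2 w \<phi> \<ge> 0\<close> and \<open>d'' - w d' - 4 d = - 2 q\<close>, so the maximum
  principle gives first \<open>q \<le> 0\<close> and then \<open>d \<le> 0\<close> on the positive half line.
\<close>

lemma partial_expectation_product_le:
  "(phi w + w * std_normal_cdf w) * (phi w + w * std_normal_cdf w - w) \<le> phi 0 * phi w"
proof -
  let ?F = std_normal_cdf
  define P where "P w = ?F w * (1 - ?F w) / phi w" for w
  define q where "q w = 1 - 2 * ?F w + w * P w" for w
  define q1 where "q1 w = - 2 * phi w + P w + w * q w" for w
  define q2 where "q2 w = 2 * w * phi w + 2 * q w + w * q1 w" for w
  define D where "D w = phi w + w * (2 * ?F w - 1) - w\<^sup>2 * P w" for w
  define d where "d w = 2 * ?F w - 1 - 2 * w * P w + w * D w" for w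
  define d1 where "d1 w = 3 * D w + w * d w - 2 * P w" for w
  define d2 where "d2 w = 4 * d w + w * d1 w - 2 * q w" for w
  note nz = less_imp_neq[OF phi_pos, symmetric]
  have DP: "(P has_real_derivative q w) (at w)" for w
    unfolding P_def q_def using nz[of w]
    by (auto intro!: derivative_eq_intros DERIV_phi DERIV_std_normal_cdf)
       (simp add: field_simps power2_eq_square)
  have Dq: "(q has_real_derivative q1 w) (at w)" for w
    unfolding q_def[abs_def] q1_def
    by (auto intro!: derivative_eq_intros DERIV_std_normal_cdf DP simp: q_def)
  have Dq1: "(q1 has_real_derivative q2 w) (at w)" for w
    unfolding q1_def[abs_def] q2_def
    by (auto intro!: derivative_eq_intros DERIV_phi DP Dq simp: q1_def algebra_simps)
  have DD: "(D has_real_derivative d w) (at w)" for w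
    unfolding D_def[abs_def] d_def
    by (auto intro!: derivative_eq_intros DERIV_phi DERIV_std_normal_cdf DP
        simp: D_def q_def algebra_simps power2_eq_square)
  have Dd: "(d has_real_derivative d1 w) (at w)" for w
    unfolding d_def[abs_def] d1_def
    by (rule derivative_eq_intros DERIV_std_normal_cdf DP DD refl)+
       (simp add: D_def d_def q_def algebra_simps power2_eq_square)
  have Dd1: "(d1 has_real_derivative d2 w) (at w)" for w
    unfolding d1_def[abs_def] d2_def
    by (auto intro!: derivative_eq_intros DP DD Dd simp: d1_def algebra_simps)
  have Phi0: "?F 0 = 1 / 2"
    using std_normal_cdf_minus[of 0] by simp
  have mills: "w * (1 - ?F w) / phi w \<le> 1" for w
    using upper_partial_expectation_nonneg[of w] phi_pos[of w] by (simp add: field_simps)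
  have mills': "w\<^sup>2 / (1 + w\<^sup>2) \<le> w * (1 - ?F w) / phi w" if "0 \<le> w" for w
  proof -
    have "w * phi w / (1 + w\<^sup>2) \<le> 1 - ?F w"
      using upper_partial_variance_nonneg[of w] by (simp add: pos_divide_le_eq add_pos_nonneg mult.commute)
    then have "w * (w * phi w / (1 + w\<^sup>2)) / phi w \<le> w * (1 - ?F w) / phi w"
      using that phi_pos[of w] by (intro divide_right_mono mult_left_mono) auto
    then show ?thesis
      using nz[of w] by (simp add: power2_eq_square)
  qed
  have wP: "w * P w = ?F w * (w * (1 - ?F w) / phi w)" for w
    by (simp add: P_def)
  \<comment> \<open>The majorant comes from the upper Mills bound: it gives
    \<open>w * P w \<le> std_normal_cdf w\<close> in the definition of \<open>q\<close>.\<close>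
  have q_le: "q w \<le> 0" if "0 \<le> w" for w
  proof (rule max_principle_half_line[OF _ Dq Dq1 _ _ _ that, where v = "\<lambda>w. 1 - ?F w"])
    show "q 0 \<le> 0" by (simp add: q_def Phi0)
    show "0 < q2 x" if "0 < x" "0 < q x" "q1 x = 0" for x
      using that phi_pos[of x] by (simp add: q2_def add_nonneg_pos)
    have "q x \<le> 1 - ?F x" for x
      using mult_left_mono[OF mills[of x] std_normal_cdf_nonneg[of x]] by (simp add: q_def wP)
    then show "\<forall>\<^sub>F x in at_top. q x \<le> 1 - ?F x" by simp
    show "((\<lambda>w. 1 - ?F w) \<longlongrightarrow> 0) at_top"
      using tendsto_diff[OF tendsto_const[of 1] std_normal_cdf_at_top] by simp
  qed
  have D_eq: "(phi w + w * ?F w) * (phi w + w * ?F w - w) = D w * phi w" for w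
    using nz[of w] by (simp add: D_def P_def field_simps power2_eq_square)
  \<comment> \<open>The majorant bounds \<open>w * P w\<close> from below by the lower Mills bound
    and \<open>w * D w\<close> from above by \<open>w * (w + 1) / (1 + w\<^sup>2)\<close>. Its terms
    tend to 2, 1, 2 and 1 with signs +, -, -, +, so they cancel in the limit.\<close>
  have d_le: "d w \<le> 0" if "0 \<le> w" for w
  proof (rule max_principle_half_line[OF _ Dd Dd1 _ _ _ that, where v =
        "\<lambda>w. 2 * ?F w - 1 - 2 * ?F w * (w\<^sup>2 / (1 + w\<^sup>2)) + w * (w + 1) / (1 + w\<^sup>2)"])
    show "d 0 \<le> 0" by (simp add: d_def Phi0)
    show "0 < d2 x" if "0 < x" "0 < d x" "d1 x = 0" for x
      using that q_le[of x] by (simp add: d2_def)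
    have "d x \<le> 2 * ?F x - 1 - 2 * ?F x * (x\<^sup>2 / (1 + x\<^sup>2)) + x * (x + 1) / (1 + x\<^sup>2)"
      if x: "0 \<le> x" for x
    proof -
      have "?F x * (x\<^sup>2 / (1 + x\<^sup>2)) \<le> x * P x"
        unfolding wP by (intro mult_left_mono mills' std_normal_cdf_nonneg x)
      moreover have "D x \<le> (x + 1) / (1 + x\<^sup>2)"
      proof -
        have "phi x \<le> 1 * 1"
          unfolding std_normal_density_def
          by (intro mult_mono) (use pi_ge_two in \<open>auto simp: real_le_rsqrt\<close>)
        then have "phi x + x * ?F x \<le> x + 1"
          using mult_left_mono[OF std_normal_cdf_le_1[of x] x] by simp
        moreover have "(phi x + x * ?F x - x) / phi x \<le> 1 / (1 + x\<^sup>2)"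
        proof -
          have "(phi x + x * ?F x - x) / phi x = 1 - x * (1 - ?F x) / phi x"
            using nz[of x] by (simp add: field_simps)
          also have "\<dots> \<le> 1 - x\<^sup>2 / (1 + x\<^sup>2)"
            using mills'[OF x] by simp
          also have "\<dots> = 1 / (1 + x\<^sup>2)"
            by (simp add: field_simps add_nonneg_eq_0_iff)
          finally show ?thesis .
        qed
        moreover have "D x = (phi x + x * ?F x) * ((phi x + x * ?F x - x) / phi x)"
          using D_eq[of x] nz[of x] by (simp add: field_simps)
        moreover have "0 \<le> (phi x + x * ?F x - x) / phi x"
          using upper_partial_expectation_nonneg[of x] phi_pos[of x] by simp
        ultimately show ?thesis
          using mult_mono[of "phi x + x * ?F x" "x + 1" "(phi x + x * ?F x - x) / phi x" "1 / (1 + x\<^sup>2)"] x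
          by simp
      qed
      then have "x * D x \<le> x * (x + 1) / (1 + x\<^sup>2)"
        using mult_left_mono[OF _ x] by fastforce
      ultimately show ?thesis by (simp add: d_def)
    qed
    then show "\<forall>\<^sub>F x in at_top. d x \<le>
        2 * ?F x - 1 - 2 * ?F x * (x\<^sup>2 / (1 + x\<^sup>2)) + x * (x + 1) / (1 + x\<^sup>2)"
      using eventually_ge_at_top[of 0] by (rule eventually_mono[rotated]) auto
    have "((\<lambda>w::real. w\<^sup>2 / (1 + w\<^sup>2)) \<longlongrightarrow> 1) at_top" "((\<lambda>w::real. w * (w + 1) / (1 + w\<^sup>2)) \<longlongrightarrow> 1) at_top"
      by real_asymp+
    then have "((\<lambda>w. 2 * ?F w - 1 - 2 * ?F w * (w\<^sup>2 / (1 + w\<^sup>2)) + w * (w + 1) / (1 + w\<^sup>2))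
        \<longlongrightarrow> 2 * 1 - 1 - 2 * 1 * 1 + 1) at_top"
      by (intro tendsto_intros std_normal_cdf_at_top)
    then show "((\<lambda>w. 2 * ?F w - 1 - 2 * ?F w * (w\<^sup>2 / (1 + w\<^sup>2)) + w * (w + 1) / (1 + w\<^sup>2))
        \<longlongrightarrow> 0) at_top" by simp
  qed
  \<comment> \<open>As \<open>d\<close> is the derivative of \<open>D\<close>, the even function
    \<open>D\<close> has its maximum at 0, where it equals \<open>phi 0\<close>.\<close>
  have "D w \<le> phi 0" if "0 \<le> w" for w
  proof -
    have "D w \<le> D 0"
      by (rule DERIV_nonpos_imp_nonincreasing[OF that]) (use DD d_le in blast)
    then show ?thesis by (simp add: D_def)
  qed
  moreover have "D (- w) = D w"
    by (simp add: D_def P_def phi_minus std_normal_cdf_minus algebra_simps)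
  ultimately have "D w \<le> phi 0"
    by (metis linear neg_0_le_iff_le)
  then show ?thesis
    unfolding D_eq using phi_pos[of w] by (intro mult_right_mono) auto
qed

section \<open>Solution of Stein's equation\<close>

lemma std_normal_exp_eq:
  assumes "h \<in> borel_measurable borel"
  shows "std_normal_exp h = (LINT x|lborel. h x * phi x)"
  unfolding std_normal_exp_def using assms
  by (subst integral_density) (auto simp: mult.commute)

lemma lipschitz_abs_le:
  fixes h :: "real \<Rightarrow> real"
  assumes "1-lipschitz_on UNIV h"
  shows "\<bar>h x - h y\<bar> \<le> \<bar>x - y\<bar>"
  using lipschitz_onD[OF assms, of x y] by (simp add: dist_real_def)

lemma integrable_lipschitz_phi:
  fixes h :: "real \<Rightarrow> real"
  assumes "1-lipschitz_on UNIV h"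
  shows "integrable lborel (\<lambda>x. h x * phi x)"
proof (rule Bochner_Integration.integrable_bound)
  show "integrable lborel (\<lambda>x. \<bar>h 0\<bar> * phi x + phi x * \<bar>x\<bar> ^ 1)"
    by (intro Bochner_Integration.integrable_add integrable_mult_right integrable_phi
        integrable_std_normal_moment_abs)
  have "h \<in> borel_measurable borel"
    using borel_measurable_continuous_onI lipschitz_on_continuous_on[OF assms] by blast
  then show "(\<lambda>x. h x * phi x) \<in> borel_measurable lborel" by simp
  show "AE x in lborel. norm (h x * phi x) \<le> norm (\<bar>h 0\<bar> * phi x + phi x * \<bar>x\<bar> ^ 1)"
  proof (rule AE_I2)
    fix x
    have "\<bar>h x\<bar> \<le> \<bar>h 0\<bar> + \<bar>x\<bar>"
      using lipschitz_abs_le[OF assms, of x 0] by linarith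
    from mult_right_mono[OF this, of "phi x"]
    show "norm (h x * phi x) \<le> norm (\<bar>h 0\<bar> * phi x + phi x * \<bar>x\<bar> ^ 1)"
      by (simp add: abs_mult algebra_simps)
  qed
qed

text \<open>Averaging \<open>h w - h x\<close> over a Gaussian \<open>x\<close> gives the bound, as
  the integrand is at most \<open>\<bar>w\<bar> + \<bar>x\<bar>\<close>. It is the origin of the
  weight of the zeroth-order remainders in the final estimate.\<close>

lemma lipschitz_minus_std_normal_exp_le:
  fixes h :: "real \<Rightarrow> real"
  assumes lip: "1-lipschitz_on UNIV h"
  shows "\<bar>h w - std_normal_exp h\<bar> \<le> \<bar>w\<bar> + std_normal_exp abs"
proof -
  have hm: "h \<in> borel_measurable borel"
    using borel_measurable_continuous_onI lipschitz_on_continuous_on[OF lip] by blast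
  have int_abs: "integrable lborel (\<lambda>x. \<bar>x\<bar> * phi x)"
    using integrable_std_normal_moment_abs[of 1] by (simp add: mult.commute)
  have "h w - std_normal_exp h = (LINT x|lborel. h w * phi x - h x * phi x)"
    by (simp add: std_normal_exp_eq[OF hm] integrable_phi integrable_lipschitz_phi[OF lip] integral_phi)
  also have "\<bar>\<dots>\<bar> \<le> (LINT x|lborel. \<bar>w\<bar> * phi x + \<bar>x\<bar> * phi x)"
  proof (rule integral_abs_bound_integral)
    show "integrable lborel (\<lambda>x. h w * phi x - h x * phi x)"
      by (simp add: integrable_phi integrable_lipschitz_phi[OF lip])
    show "integrable lborel (\<lambda>x. \<bar>w\<bar> * phi x + \<bar>x\<bar> * phi x)"
      by (simp add: integrable_phi int_abs)
    fix x
    have "\<bar>h w - h x\<bar> \<le> \<bar>w\<bar> + \<bar>x\<bar>"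
      using lipschitz_abs_le[OF lip, of w x] by linarith
    from mult_right_mono[OF this, of "phi x"]
    show "\<bar>h w * phi x - h x * phi x\<bar> \<le> \<bar>w\<bar> * phi x + \<bar>x\<bar> * phi x"
      by (simp add: abs_mult left_diff_distrib[symmetric] distrib_right)
  qed
  also have "\<dots> = \<bar>w\<bar> + std_normal_exp abs"
    by (simp add: std_normal_exp_eq integrable_phi int_abs integral_phi)
  finally show ?thesis .
qed

text \<open>The constant 1 is half the Lipschitz constant 2, as in a second-order Taylor remainder,
  but a monotonicity argument avoids the second derivative.\<close>

lemma taylor_lipschitz_deriv:
  fixes f f' :: "real \<Rightarrow> real"
  assumes deriv: "\<And>x. (f has_real_derivative f' x) (at x)"
    and lip: "\<And>x y. \<bar>f' x - f' y\<bar> \<le> 2 * \<bar>x - y\<bar>"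
  shows "\<bar>f v - f w - (v - w) * f' w\<bar> \<le> (v - w)\<^sup>2"
proof -
  have up: "g v - g w - (v - w) * g' w \<le> (v - w)\<^sup>2"
    if g: "\<And>x. (g has_real_derivative g' x) (at x)"
      and gl: "\<And>x y. \<bar>g' x - g' y\<bar> \<le> 2 * \<bar>x - y\<bar>" for g g' :: "real \<Rightarrow> real"
  proof -
    \<comment> \<open>The Lipschitz bound on \<open>g'\<close> makes \<open>r\<close> increase up to
      \<open>w\<close> and decrease afterwards, so \<open>w\<close> is its maximum. Applying this to
      \<open>f\<close> and to \<open>- f\<close> gives both sides of the estimate.\<close>
    define r where "r x = g x - g w - (x - w) * g' w - (x - w)\<^sup>2" for x
    have r: "(r has_real_derivative g' x - g' w - 2 * (x - w)) (at x)" for x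
      unfolding r_def by (auto intro!: derivative_eq_intros g)
    have "r v \<le> r w"
    proof (cases "w \<le> v")
      case True
      show ?thesis
      proof (rule DERIV_nonpos_imp_nonincreasing[OF True])
        fix x assume "w \<le> x" "x \<le> v"
        with r gl[of x w] show "\<exists>y. (r has_real_derivative y) (at x) \<and> y \<le> 0"
          by (intro exI conjI) (auto simp: abs_le_iff)
      qed
    next
      case False
      then have "v \<le> w" by simp
      then show ?thesis
      proof (rule DERIV_nonneg_imp_nondecreasing)
        fix x assume "v \<le> x" "x \<le> w"
        with r gl[of x w] show "\<exists>y. (r has_real_derivative y) (at x) \<and> 0 \<le> y"
          by (intro exI conjI) (auto simp: abs_le_iff)
      qed
    qed
    then show ?thesis by (simp add: r_def)
  qed
  have "- f v - - f w - (v - w) * - f' w \<le> (v - w)\<^sup>2"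
  proof (rule up)
    show "\<bar>- f' x - - f' y\<bar> \<le> 2 * \<bar>x - y\<bar>" for x y
      using lip[of x y] by (simp add: abs_minus_commute)
  qed (auto intro!: derivative_eq_intros deriv)
  then show ?thesis
    using up[of f f'] deriv lip by (simp add: abs_le_iff)
qed

lemma abs_linear_combination_le:
  fixes a b s t A B :: real
  assumes "\<bar>a\<bar> \<le> A" "\<bar>b\<bar> \<le> B" "0 \<le> s" "0 \<le> t"
  shows "\<bar>s * a - t * b\<bar> \<le> s * A + t * B"
proof -
  have "\<bar>s * a - t * b\<bar> \<le> s * \<bar>a\<bar> + t * \<bar>b\<bar>"
    using assms abs_triangle_ineq4[of "s * a" "t * b"] by (simp add: abs_mult)
  also have "\<dots> \<le> s * A + t * B"
    using assms by (intro add_mono mult_left_mono)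
  finally show ?thesis .
qed

text \<open>
  At a point \<open>w\<close> put \<open>a = \<integral>\<^bsub>x \<le> w\<^esub> (h x - h w) \<phi> x\<close> and \<open>b = \<integral>\<^bsub>x > w\<^esub> (h x - h w) \<phi> x\<close>. Each of \<open>f\<close>, \<open>f'\<close>
  and \<open>(w f)'\<close> equals \<open>s a - t b\<close> with \<open>s\<close> and \<open>t\<close> of known sign (Mills ratio bounds), so it is
  largest for \<open>h x = \<plusminus> \<bar>x - w\<bar>\<close> or \<open>h x = \<plusminus> (x - w)\<close>, where it is explicit. Splitting off \<open>w f\<close> in
  \<open>f' = w f + h - \<E> h\<close> bounds the Lipschitz constant of \<open>f'\<close> without differentiating \<open>h\<close>.
\<close>

lemma stein_solution:
  fixes h :: "real \<Rightarrow> real"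
  assumes lip: "1-lipschitz_on UNIV h"
  obtains f f' where
    "\<And>w. (f has_real_derivative f' w) (at w)"
    "\<And>w. f' w - w * f w = h w - std_normal_exp h"
    "\<And>w. \<bar>f w\<bar> \<le> 1"
    "\<And>w. \<bar>f' w\<bar> \<le> sqrt (2 / pi)"
    "\<And>v w. \<bar>f' v - f' w\<bar> \<le> 2 * \<bar>v - w\<bar>"
proof -
  let ?F = std_normal_cdf
  define c where "c = std_normal_exp h"
  define G where "G w = (LINT x:{..w}|lborel. (h x - c) * phi x)" for w
  define f where "f w = G w / phi w" for w
  define f' where "f' w = w * f w + (h w - c)" for w
  note nz = less_imp_neq[OF phi_pos, symmetric]
  have conth: "continuous_on UNIV h"
    by (rule lipschitz_on_continuous_on[OF lip])
  have hm [measurable]: "h \<in> borel_measurable borel"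
    using borel_measurable_continuous_onI conth by blast
  have int: "integrable lborel (\<lambda>x. (h x - e) * phi x)" for e
    using integrable_lipschitz_phi[OF lip] integrable_phi by (simp add: left_diff_distrib)
  have DG: "(G has_real_derivative (h w - c) * phi w) (at w)" for w
    unfolding G_def[abs_def]
    by (intro has_real_derivative_LINT_atMost int continuous_intros conth)
  have Df: "(f has_real_derivative f' w) (at w)" for w
  proof -
    have "((\<lambda>w. G w / phi w) has_real_derivative
        ((h w - c) * phi w * phi w - G w * (- w * phi w)) / (phi w * phi w)) (at w)"
      by (rule DERIV_divide[OF DG DERIV_phi nz])
    moreover have "((h w - c) * phi w * phi w - G w * (- w * phi w)) / (phi w * phi w) = f' w"
      using nz[of w] by (simp add: f'_def f_def field_simps)
    ultimately show ?thesis by (simp add: f_def[abs_def])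
  qed
  have *: "\<exists>a b. \<bar>a\<bar> \<le> phi w + w * ?F w \<and> \<bar>b\<bar> \<le> phi w + w * ?F w - w
      \<and> f w = ((1 - ?F w) * a - ?F w * b) / phi w \<and> h w - c = - (a + b)" for w
  proof -
    define g where "g x = (h x - h w) * phi x" for x
    have ig: "integrable lborel g"
      unfolding g_def by (rule int)
    have il: "integrable lborel (\<lambda>x. (w - x) * phi x)"
      using integrable_phi integrable_phi_x by (simp add: left_diff_distrib)
    have sint: "set_integrable lborel S k" if "integrable lborel k" "S \<in> sets borel"
      for S and k :: "real \<Rightarrow> real"
      using that set_integrable_subset[of lborel UNIV k S] by (auto simp: set_integrable_def)
    have split: "(LINT x|lborel. k x) = (LINT x:{..w}|lborel. k x) + (LINT x:{w<..}|lborel. k x)"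
      if "integrable lborel k" for k :: "real \<Rightarrow> real"
    proof -
      have "{..w} \<union> {w<..} = UNIV" by auto
      then show ?thesis
        using set_integral_Un[of "{..w}" "{w<..}" lborel k] sint[OF that]
        by (simp add: set_lebesgue_integral_def disjoint_iff)
    qed
    define a where "a = (LINT x:{..w}|lborel. g x)"
    define b where "b = (LINT x:{w<..}|lborel. g x)"
    have gle: "\<bar>g x\<bar> \<le> \<bar>w - x\<bar> * phi x" for x
      using lipschitz_abs_le[OF lip, of x w]
      by (auto simp: g_def abs_mult abs_minus_commute intro!: mult_right_mono)
    have "\<bar>a\<bar> \<le> (LINT x:{..w}|lborel. (w - x) * phi x)"
      unfolding a_def set_lebesgue_integral_def
    proof (rule integral_abs_bound_integral)
      fix x show "\<bar>indicat_real {..w} x *\<^sub>R g x\<bar> \<le> indicat_real {..w} x *\<^sub>R ((w - x) * phi x)"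
        using gle[of x] by (auto simp: indicator_def)
    qed (use sint[OF ig] sint[OF il] in \<open>auto simp: set_integrable_def\<close>)
    then have a: "\<bar>a\<bar> \<le> phi w + w * ?F w"
      by (simp add: LINT_atMost_diff)
    have "\<bar>b\<bar> \<le> (LINT x:{w<..}|lborel. - ((w - x) * phi x))"
      unfolding b_def set_lebesgue_integral_def
    proof (rule integral_abs_bound_integral)
      fix x show "\<bar>indicat_real {w<..} x *\<^sub>R g x\<bar> \<le> indicat_real {w<..} x *\<^sub>R - ((w - x) * phi x)"
        using gle[of x] by (auto simp: indicator_def algebra_simps)
    qed (use sint[OF ig] sint[OF il] in \<open>auto simp: set_integrable_def\<close>)
    also have "\<dots> = - (LINT x:{w<..}|lborel. (w - x) * phi x)"
      by (simp add: set_lebesgue_integral_def)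
    also have "(LINT x:{w<..}|lborel. (w - x) * phi x) =
        (LINT x|lborel. (w - x) * phi x) - (w * ?F w + phi w)"
      using split[OF il] by (simp add: LINT_atMost_diff)
    also have "(LINT x|lborel. (w - x) * phi x) = w"
      by (simp add: left_diff_distrib integrable_phi integrable_phi_x integral_phi integral_phi_x)
    finally have b: "\<bar>b\<bar> \<le> phi w + w * ?F w - w" by simp
    have "c - h w = (LINT x|lborel. g x)"
      using integrable_lipschitz_phi[OF lip]
      by (simp add: g_def c_def std_normal_exp_eq[OF hm] left_diff_distrib integrable_phi integral_phi)
    then have sum: "c - h w = a + b"
      using split[OF ig] by (simp add: a_def b_def)
    have "G w = (LINT x:{..w}|lborel. g x + (h w - c) * phi x)"
      unfolding G_def g_def by (simp add: algebra_simps)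
    also have "\<dots> = a + (LINT x:{..w}|lborel. (h w - c) * phi x)"
      unfolding a_def by (intro set_integral_add(2) sint ig integrable_mult_right integrable_phi) auto
    also have "\<dots> = a + (h w - c) * ?F w"
      by (simp add: std_normal_cdf_def)
    also have "h w - c = - (a + b)"
      using sum by simp
    finally have "f w = ((1 - ?F w) * a - ?F w * b) / phi w"
      by (simp add: f_def algebra_simps)
    with a b sum show ?thesis by (intro exI[of _ a] exI[of _ b]) auto
  qed
  \<comment> \<open>Inserting the extreme values of \<open>a\<close> and \<open>b\<close> leaves
    exactly \<open>phi w\<close>, which cancels the denominator of \<open>f w\<close>.\<close>
  have f_le: "\<bar>f w\<bar> \<le> 1" for w
  proof -
    obtain a b where ab: "\<bar>a\<bar> \<le> phi w + w * ?F w" "\<bar>b\<bar> \<le> phi w + w * ?F w - w"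
      and fw: "f w = ((1 - ?F w) * a - ?F w * b) / phi w"
      using * by blast
    have "\<bar>(1 - ?F w) * a - ?F w * b\<bar> \<le>
        (1 - ?F w) * (phi w + w * ?F w) + ?F w * (phi w + w * ?F w - w)"
      by (intro abs_linear_combination_le ab)
         (use std_normal_cdf_nonneg[of w] std_normal_cdf_le_1[of w] in auto)
    also have "\<dots> = phi w"
      by (simp add: algebra_simps)
    finally show ?thesis
      using phi_pos[of w] by (simp add: fw)
  qed
  have f'_le: "\<bar>f' w\<bar> \<le> sqrt (2 / pi)" for w
  proof -
    let ?A = "phi w + w * ?F w" and ?B = "phi w + w * ?F w - w"
    obtain a b where ab: "\<bar>a\<bar> \<le> ?A" "\<bar>b\<bar> \<le> ?B"
      and fw: "f w = ((1 - ?F w) * a - ?F w * b) / phi w" and hw: "h w - c = - (a + b)"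
      using * by blast
    \<comment> \<open>The weights of \<open>a\<close> and \<open>b\<close> are the bounds of the
      respective other one, so twice the product \<open>?A * ?B\<close> appears. This is where the
      product inequality is needed.\<close>
    have "- f' w * phi w = ?B * a - ?A * (- b)"
      using nz[of w] by (simp add: f'_def fw hw field_simps)
    moreover have "\<bar>?B * a - ?A * (- b)\<bar> \<le> ?B * ?A + ?A * ?B"
      by (intro abs_linear_combination_le)
         (use ab upper_partial_expectation_nonneg[of w] lower_partial_expectation_nonneg[of w] in auto)
    moreover have "\<dots> \<le> 2 * phi 0 * phi w"
      using partial_expectation_product_le[of w] by (simp add: mult.commute)
    moreover have "\<bar>f' w\<bar> * phi w = \<bar>- f' w * phi w\<bar>"
      by (simp add: abs_mult)
    ultimately have "\<bar>f' w\<bar> * phi w \<le> 2 * phi 0 * phi w"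
      by linarith
    then have "\<bar>f' w\<bar> \<le> 2 * phi 0"
      using phi_pos[of w] by simp
    also have "\<dots> = sqrt (2 / pi)"
      by (rule real_sqrt_unique[symmetric])
         (auto simp: std_normal_density_def power_mult_distrib power_divide)
    finally show ?thesis .
  qed
  \<comment> \<open>Eliminating \<open>f'\<close> by Stein's equation leaves the two partial second
    moments as weights; the extreme combination again collapses to \<open>phi w\<close>.\<close>
  have wf: "\<bar>f w + w * f' w\<bar> \<le> 1" for w
  proof -
    let ?s = "(1 + w\<^sup>2) * (1 - ?F w) - w * phi w" and ?t = "(1 + w\<^sup>2) * ?F w + w * phi w"
    obtain a b where ab: "\<bar>a\<bar> \<le> phi w + w * ?F w" "\<bar>b\<bar> \<le> phi w + w * ?F w - w"
      and fw: "f w = ((1 - ?F w) * a - ?F w * b) / phi w" and hw: "h w - c = - (a + b)"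
      using * by blast
    have "(f w + w * f' w) * phi w = ?s * a - ?t * b"
      using nz[of w] by (simp add: f'_def fw hw field_simps power2_eq_square)
    moreover have "\<bar>?s * a - ?t * b\<bar> \<le> ?s * (phi w + w * ?F w) + ?t * (phi w + w * ?F w - w)"
      by (intro abs_linear_combination_le ab)
         (use upper_partial_variance_nonneg[of w] lower_partial_variance_nonneg[of w] in auto)
    moreover have "\<dots> = phi w"
      by (simp add: algebra_simps power2_eq_square)
    moreover have "\<bar>f w + w * f' w\<bar> * phi w = \<bar>(f w + w * f' w) * phi w\<bar>"
      by (simp add: abs_mult)
    ultimately have "\<bar>f w + w * f' w\<bar> * phi w \<le> 1 * phi w"
      by linarith
    then show ?thesis
      using phi_pos[of w] by simp
  qed
  have lip_wf: "\<bar>v * f v - w * f w\<bar> \<le> \<bar>v - w\<bar>" for v w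
  proof -
    have "norm (v * f v - w * f w) \<le> 1 * norm (v - w)"
    proof (rule field_differentiable_bound[of UNIV])
      show "((\<lambda>x. x * f x) has_field_derivative f x + x * f' x) (at x within UNIV)" for x
        by (auto intro!: derivative_eq_intros Df)
    qed (use wf in auto)
    then show ?thesis by simp
  qed
  show thesis
  proof (rule that[of f f'])
    show "f' w - w * f w = h w - std_normal_exp h" for w
      by (simp add: f'_def c_def)
    show "\<bar>f' v - f' w\<bar> \<le> 2 * \<bar>v - w\<bar>" for v w
      using abs_triangle_ineq[of "v * f v - w * f w" "h v - h w"] lip_wf[of v w]
        lipschitz_abs_le[OF lip, of v w] by (simp add: f'_def algebra_simps)
  qed (use Df f_le f'_le in auto)
qed

section \<open>Exchangeable pairs\<close>

lemma integrable_bounded_mult: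
  fixes u g :: "'a \<Rightarrow> real"
  assumes "integrable M g" and [measurable]: "u \<in> borel_measurable M" and "\<And>x. \<bar>u x\<bar> \<le> K"
  shows "integrable M (\<lambda>x. u x * g x)"
proof (rule Bochner_Integration.integrable_bound)
  show "integrable M (\<lambda>x. K * \<bar>g x\<bar>)" using assms by simp
  show "(\<lambda>x. u x * g x) \<in> borel_measurable M"
    using borel_measurable_integrable[OF assms(1)] by measurable
  show "AE x in M. norm (u x * g x) \<le> norm (K * \<bar>g x\<bar>)"
  proof (rule AE_I2)
    fix x
    have "\<bar>u x\<bar> * \<bar>g x\<bar> \<le> K * \<bar>g x\<bar>"
      by (intro mult_right_mono assms) simp
    moreover have "0 \<le> K"
      using assms(3)[of x] by linarith
    ultimately show "norm (u x * g x) \<le> norm (K * \<bar>g x\<bar>)"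
      by (simp add: abs_mult)
  qed
qed

lemma integral_abs_le_integral:
  fixes f g :: "'a \<Rightarrow> real"
  assumes "integrable M f" "integrable M g" "\<And>x. x \<in> space M \<Longrightarrow> \<bar>f x\<bar> \<le> g x"
  shows "\<bar>\<integral>x. f x \<partial>M\<bar> \<le> (\<integral>x. g x \<partial>M)"
  by (rule order_trans[OF integral_abs_bound integral_mono]) (use assms in auto)

lemma integral_bounded_mult_le:
  fixes u v g :: "'a \<Rightarrow> real"
  assumes "integrable M (\<lambda>x. v x * g x)" and "u \<in> borel_measurable M" "v \<in> borel_measurable M"
    and "\<And>x. \<bar>u x\<bar> \<le> K" "\<And>x. 0 \<le> v x"
  shows "\<bar>\<integral>x. u x * v x * g x \<partial>M\<bar> \<le> K * (\<integral>x. \<bar>g x\<bar> * v x \<partial>M)"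
proof -
  have K: "0 \<le> K" using assms(4)[of undefined] by linarith
  have "\<bar>\<integral>x. u x * (v x * g x) \<partial>M\<bar> \<le> (\<integral>x. K * \<bar>v x * g x\<bar> \<partial>M)"
  proof (rule integral_abs_le_integral)
    show "\<bar>u x * (v x * g x)\<bar> \<le> K * \<bar>v x * g x\<bar>" for x
      using mult_right_mono[OF assms(4)[of x], of "\<bar>v x * g x\<bar>"] by (simp add: abs_mult)
  qed (use assms integrable_bounded_mult[OF assms(1,2,4)] in auto)
  then show ?thesis
    using assms(5) by (simp add: abs_mult mult_ac)
qed

locale exchangeable_pair = prob_space M for M :: "'a measure" +
  fixes W Y W' Y' :: "'a \<Rightarrow> real"
  assumes meas [measurable]: "W \<in> borel_measurable M" "Y \<in> borel_measurable M"
              "W' \<in> borel_measurable M" "Y' \<in> borel_measurable M"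
    and W_square_integrable: "integrable M (\<lambda>x. (W x)\<^sup>2)"
    and exch: "distr M borel (\<lambda>x. (W x, Y x, W' x, Y' x)) = distr M borel (\<lambda>x. (W' x, Y' x, W x, Y x))"
begin

lemma
  fixes G :: "real \<times> real \<times> real \<times> real \<Rightarrow> real"
  assumes G [measurable]: "G \<in> borel_measurable borel"
  shows exchange_integral: "(\<integral>x. G (W x, Y x, W' x, Y' x) \<partial>M) = (\<integral>x. G (W' x, Y' x, W x, Y x) \<partial>M)"
    and exchange_integrable: "integrable M (\<lambda>x. G (W x, Y x, W' x, Y' x)) \<longleftrightarrow>
      integrable M (\<lambda>x. G (W' x, Y' x, W x, Y x))"
proof -
  have [measurable]: "(\<lambda>x. (W x, Y x, W' x, Y' x)) \<in> borel_measurable M"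
    "(\<lambda>x. (W' x, Y' x, W x, Y x)) \<in> borel_measurable M"
    by (simp_all add: borel_prod[symmetric])
  show "(\<integral>x. G (W x, Y x, W' x, Y' x) \<partial>M) = (\<integral>x. G (W' x, Y' x, W x, Y x) \<partial>M)"
    using arg_cong[OF exch, of "\<lambda>N. integral\<^sup>L N G"] by (simp add: integral_distr)
  show "integrable M (\<lambda>x. G (W x, Y x, W' x, Y' x)) \<longleftrightarrow> integrable M (\<lambda>x. G (W' x, Y' x, W x, Y x))"
    using arg_cong[OF exch, of "\<lambda>N. integrable N G"] by (simp add: integrable_distr_eq)
qed

lemma integrable_W: "integrable M W"
  by (rule square_integrable_imp_integrable[OF _ W_square_integrable]) simp

lemma integrable_diff_square: "integrable M (\<lambda>x. (W' x - W x)\<^sup>2)"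
proof (rule Bochner_Integration.integrable_bound)
  have "integrable M (\<lambda>x. (W' x)\<^sup>2)"
    using exchange_integrable[of "\<lambda>z. (fst z)\<^sup>2"] W_square_integrable
    by (simp add: borel_prod[symmetric])
  then show "integrable M (\<lambda>x. 2 * (W' x)\<^sup>2 + 2 * (W x)\<^sup>2)"
    using W_square_integrable by simp
  have "(s - t)\<^sup>2 \<le> 2 * s\<^sup>2 + 2 * t\<^sup>2" for s t :: real
    using zero_le_power2[of "s + t"] by (simp add: power2_diff power2_sum)
  then show "AE x in M. norm ((W' x - W x)\<^sup>2) \<le> norm (2 * (W' x)\<^sup>2 + 2 * (W x)\<^sup>2)"
    by (simp add: abs_of_nonneg)
qed simp

lemma integrable_diff: "integrable M (\<lambda>x. W' x - W x)"
  by (rule square_integrable_imp_integrable[OF _ integrable_diff_square]) simp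

lemma subalgebra_sigma_pair: "subalgebra M (sigma_pair M W Y)"
proof -
  have "(\<lambda>x. (W x, Y x)) \<in> M \<rightarrow>\<^sub>M borel"
    by (simp add: borel_prod[symmetric])
  then show ?thesis
    unfolding subalgebra_def sigma_pair_def by (auto intro: measurable_sets simp: sets_vimage_algebra2)
qed

sublocale pair: finite_measure_subalgebra M "sigma_pair M W Y"
  by unfold_locales (rule subalgebra_sigma_pair)

text \<open>The defining property of conditional expectation, tested against functions of
  \<open>(W, Y)\<close>. The version \<open>r\<close> need only agree almost everywhere, and
  integrability on its side is a conclusion: this is how the remainders acquire their
  integrability.\<close>

lemma
  fixes u :: "real \<times> real \<Rightarrow> real" and g r :: "'a \<Rightarrow> real"
  assumes u: "u \<in> borel_measurable borel"
    and g: "g \<in> borel_measurable M" and r: "r \<in> borel_measurable M"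
    and eq: "AE x in M. real_cond_exp M (sigma_pair M W Y) g x = r x"
    and int: "integrable M (\<lambda>x. u (W x, Y x) * g x)"
  shows integrable_cond_exp_pair: "integrable M (\<lambda>x. u (W x, Y x) * r x)"
    and integral_cond_exp_pair: "(\<integral>x. u (W x, Y x) * g x \<partial>M) = (\<integral>x. u (W x, Y x) * r x \<partial>M)"
proof -
  have m: "(\<lambda>x. u (W x, Y x)) \<in> borel_measurable (sigma_pair M W Y)"
    unfolding sigma_pair_def by (rule measurable_compose[OF measurable_vimage_algebra1 u]) simp
  have AE: "AE x in M. u (W x, Y x) * real_cond_exp M (sigma_pair M W Y) g x = u (W x, Y x) * r x"
    using eq by eventually_elim simp
  have mM: "(\<lambda>x. u (W x, Y x)) \<in> borel_measurable M"
    by (rule measurable_from_subalg[OF subalgebra_sigma_pair m])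
  have me: "(\<lambda>x. u (W x, Y x) * real_cond_exp M (sigma_pair M W Y) g x) \<in> borel_measurable M"
    using mM by measurable
  have mr: "(\<lambda>x. u (W x, Y x) * r x) \<in> borel_measurable M"
    using mM r by measurable
  show "integrable M (\<lambda>x. u (W x, Y x) * r x)"
    using pair.real_cond_exp_intg(1)[OF int m g] integrable_cong_AE[OF me mr AE] by blast
  show "(\<integral>x. u (W x, Y x) * g x \<partial>M) = (\<integral>x. u (W x, Y x) * r x \<partial>M)"
    using pair.real_cond_exp_intg(2)[OF int m g] integral_cong_AE[OF me mr AE] by simp
qed

section \<open>Levels of \<open>Y\<close> and crossings between neighbouring levels\<close>

definition atY :: "real \<Rightarrow> 'a \<Rightarrow> real" where
  "atY c x = (if Y x = c then 1 else 0)"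

text \<open>A real 0-1 factor in place of a set lets crossings enter integrands as products, and the
  \<open>if\<close> form agrees literally with the conditional moment hypotheses, which are then
  obtained by folding.\<close>

definition step :: "real \<Rightarrow> 'a \<Rightarrow> real" where
  "step j x = (if Y' x - Y x = j then 1 else 0)"

lemma atY_measurable [measurable]: "atY c \<in> borel_measurable M"
  unfolding atY_def[abs_def] by measurable

lemma step_measurable [measurable]: "step j \<in> borel_measurable M"
  unfolding step_def[abs_def] by measurable

lemma atY_nonneg: "0 \<le> atY c x" and abs_atY_le: "\<bar>atY c x\<bar> \<le> 1"
  and abs_step_le: "\<bar>step j x\<bar> \<le> 1"
  by (auto simp: atY_def step_def)

lemma integrable_mult_atY:
  assumes "integrable M g"
  shows "integrable M (\<lambda>x. atY c x * g x)"
  by (rule integrable_bounded_mult[OF assms _ abs_atY_le]) simp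

lemma integrable_mult_step:
  assumes "integrable M g"
  shows "integrable M (\<lambda>x. g x * step j x)"
  using integrable_bounded_mult[OF assms _ abs_step_le[of j]] by (simp add: mult.commute)

text \<open>For one level and one direction, conditioning turns the first two terms of the expansion
  into the left side of Stein's equation, scaled by \<open>lam * \<psi>\<close>. Only the remainders
  \<open>R1\<close> and \<open>R2\<close> survive, weighted by the bounds on \<open>f\<close> and
  \<open>f'\<close>.\<close>

lemma one_sided_stein_identity:
  fixes f f' :: "real \<Rightarrow> real" and R1 R2 :: "'a \<Rightarrow> real"
  assumes [measurable]: "f \<in> borel_measurable borel" "f' \<in> borel_measurable borel"
      "R1 \<in> borel_measurable M" "R2 \<in> borel_measurable M"
    and f: "\<And>w. \<bar>f w\<bar> \<le> 1" and f': "\<And>w. \<bar>f' w\<bar> \<le> s"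
    and lam: "0 < lam"
    and M1: "AE x in M. real_cond_exp M (sigma_pair M W Y)
          (\<lambda>x. (W' x - W x) * step j x) x = - lam * (\<psi> * W x / 2 + R1 x)"
    and M2: "AE x in M. real_cond_exp M (sigma_pair M W Y)
          (\<lambda>x. (W' x - W x)\<^sup>2 * step j x) x = lam * (\<psi> + R2 x)"
  shows "integrable M R1" "integrable M R2"
    and "\<bar>2 * (\<integral>x. f (W x) * atY c x * ((W' x - W x) * step j x) \<partial>M)
      + (\<integral>x. f' (W x) * atY c x * ((W' x - W x)\<^sup>2 * step j x) \<partial>M)
      - lam * \<psi> * (\<integral>x. (f' (W x) - W x * f (W x)) * atY c x \<partial>M)\<bar>
      \<le> 2 * lam * (\<integral>x. \<bar>R1 x\<bar> * atY c x \<partial>M) + lam * s * (\<integral>x. \<bar>R2 x\<bar> * atY c x \<partial>M)"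
proof -
  let ?g1 = "\<lambda>x. (W' x - W x) * step j x" and ?g2 = "\<lambda>x. (W' x - W x)\<^sup>2 * step j x"
  let ?r1 = "\<lambda>x. - lam * (\<psi> * W x / 2 + R1 x)" and ?r2 = "\<lambda>x. lam * (\<psi> + R2 x)"
  have g1: "integrable M ?g1" and g2: "integrable M ?g2"
    by (intro integrable_mult_step integrable_diff integrable_diff_square)+
  \<comment> \<open>Testing the moment condition against the constant 1 shows that its right-hand
    side is integrable; solving for the remainder then makes \<open>R1\<close> integrable, because
    \<open>W\<close> is.\<close>
  have r1: "integrable M ?r1"
    using integrable_cond_exp_pair[OF _ _ _ M1, of "\<lambda>_. 1"] g1 by simp
  have "integrable M (\<lambda>x. - (1 / lam) * ?r1 x - \<psi> / 2 * W x)"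
    using integrable_W by (intro Bochner_Integration.integrable_diff integrable_mult_right[OF r1]) simp
  moreover have "- (1 / lam) * ?r1 x - \<psi> / 2 * W x = R1 x" for x
    using lam by (simp add: field_simps)
  ultimately show R1: "integrable M R1" by simp
  have "integrable M ?r2"
    using integrable_cond_exp_pair[OF _ _ _ M2, of "\<lambda>_. 1"] g2 by simp
  then have "integrable M (\<lambda>x. 1 / lam * ?r2 x - \<psi>)"
    by (intro Bochner_Integration.integrable_diff integrable_mult_right) auto
  moreover have "1 / lam * ?r2 x - \<psi> = R2 x" for x
    using lam by (simp add: field_simps)
  ultimately show R2: "integrable M R2" by simp
  have bf: "\<bar>f (W x) * atY c x\<bar> \<le> 1" and bf': "\<bar>f' (W x) * atY c x\<bar> \<le> s" for x
    using f[of "W x"] f'[of "W x"] by (auto simp: atY_def)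
  have mf [measurable]: "(\<lambda>x. f (W x) * atY c x) \<in> borel_measurable M"
    "(\<lambda>x. f' (W x) * atY c x) \<in> borel_measurable M"
    by measurable
  have I1: "integrable M (\<lambda>x. f (W x) * atY c x * g x)" and
    I2: "integrable M (\<lambda>x. f' (W x) * atY c x * g x)" if "integrable M g" for g
    by (rule integrable_bounded_mult[OF that _ bf] integrable_bounded_mult[OF that _ bf'], simp)+
  have u: "(\<lambda>z. f (fst z) * (if snd z = c then 1 else 0)) \<in> borel_measurable borel"
    "(\<lambda>z. f' (fst z) * (if snd z = c then 1 else 0)) \<in> borel_measurable borel"
    unfolding borel_prod[symmetric] by measurable
  have e1: "(\<integral>x. f (W x) * atY c x * ?g1 x \<partial>M) = (\<integral>x. f (W x) * atY c x * ?r1 x \<partial>M)"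
    using integral_cond_exp_pair[OF u(1) _ _ M1] I1[OF g1] by (simp add: atY_def)
  have e2: "(\<integral>x. f' (W x) * atY c x * ?g2 x \<partial>M) = (\<integral>x. f' (W x) * atY c x * ?r2 x \<partial>M)"
    using integral_cond_exp_pair[OF u(2) _ _ M2] I2[OF g2] by (simp add: atY_def)
  have J: "integrable M (\<lambda>x. f (W x) * atY c x * W x)" "integrable M (\<lambda>x. f (W x) * atY c x * R1 x)"
    "integrable M (\<lambda>x. f' (W x) * atY c x * 1)" "integrable M (\<lambda>x. f' (W x) * atY c x * R2 x)"
    by (rule I1 I2 integrable_W R1 R2 integrable_const)+
  have "(\<integral>x. f (W x) * atY c x * ?r1 x \<partial>M) =
      (\<integral>x. - (lam * \<psi> / 2) * (f (W x) * atY c x * W x) - lam * (f (W x) * atY c x * R1 x) \<partial>M)"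
    by (intro Bochner_Integration.integral_cong refl) (simp add: algebra_simps)
  also have "\<dots> = - (lam * \<psi> / 2) * (\<integral>x. f (W x) * atY c x * W x \<partial>M)
      - lam * (\<integral>x. f (W x) * atY c x * R1 x \<partial>M)"
    by (subst Bochner_Integration.integral_diff)
       (intro integrable_mult_right J, intro integrable_mult_right J, simp only: integral_mult_right_zero)
  finally have e1': "(\<integral>x. f (W x) * atY c x * ?r1 x \<partial>M) =
      - (lam * \<psi> / 2) * (\<integral>x. f (W x) * atY c x * W x \<partial>M)
      - lam * (\<integral>x. f (W x) * atY c x * R1 x \<partial>M)" .
  have "(\<integral>x. f' (W x) * atY c x * ?r2 x \<partial>M) =
      (\<integral>x. lam * \<psi> * (f' (W x) * atY c x * 1) + lam * (f' (W x) * atY c x * R2 x) \<partial>M)"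
    by (intro Bochner_Integration.integral_cong refl) (simp add: algebra_simps)
  also have "\<dots> = lam * \<psi> * (\<integral>x. f' (W x) * atY c x * 1 \<partial>M) + lam * (\<integral>x. f' (W x) * atY c x * R2 x \<partial>M)"
    by (subst Bochner_Integration.integral_add)
       (intro integrable_mult_right J, intro integrable_mult_right J, simp only: integral_mult_right_zero)
  finally have e2': "(\<integral>x. f' (W x) * atY c x * ?r2 x \<partial>M) =
      lam * \<psi> * (\<integral>x. f' (W x) * atY c x * 1 \<partial>M) + lam * (\<integral>x. f' (W x) * atY c x * R2 x \<partial>M)" .
  have "(\<integral>x. (f' (W x) - W x * f (W x)) * atY c x \<partial>M) =
      (\<integral>x. f' (W x) * atY c x * 1 - f (W x) * atY c x * W x \<partial>M)"
    by (intro Bochner_Integration.integral_cong refl) (simp add: algebra_simps)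
  also have "\<dots> = (\<integral>x. f' (W x) * atY c x * 1 \<partial>M) - (\<integral>x. f (W x) * atY c x * W x \<partial>M)"
    by (intro Bochner_Integration.integral_diff J)
  finally have V: "(\<integral>x. (f' (W x) - W x * f (W x)) * atY c x \<partial>M) =
      (\<integral>x. f' (W x) * atY c x * 1 \<partial>M) - (\<integral>x. f (W x) * atY c x * W x \<partial>M)" .
  have "\<bar>\<integral>x. f (W x) * atY c x * R1 x \<partial>M\<bar> \<le> 1 * (\<integral>x. \<bar>R1 x\<bar> * atY c x \<partial>M)"
    by (intro integral_bounded_mult_le integrable_mult_atY R1 f atY_nonneg) measurable
  from mult_left_mono[OF this, of "2 * lam"] lam
  have b1: "\<bar>2 * lam * (\<integral>x. f (W x) * atY c x * R1 x \<partial>M)\<bar> \<le> 2 * lam * (\<integral>x. \<bar>R1 x\<bar> * atY c x \<partial>M)"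
    by (simp add: abs_mult)
  have "\<bar>\<integral>x. f' (W x) * atY c x * R2 x \<partial>M\<bar> \<le> s * (\<integral>x. \<bar>R2 x\<bar> * atY c x \<partial>M)"
    by (intro integral_bounded_mult_le integrable_mult_atY R2 f' atY_nonneg) measurable
  from mult_left_mono[OF this, of lam] lam
  have b2: "\<bar>lam * (\<integral>x. f' (W x) * atY c x * R2 x \<partial>M)\<bar> \<le> lam * s * (\<integral>x. \<bar>R2 x\<bar> * atY c x \<partial>M)"
    by (simp add: abs_mult mult.assoc)
  \<comment> \<open>The factor 2 turns the drift \<open>\<psi> * W / 2\<close> into
    \<open>\<psi> * W\<close>, which matches the variance term \<open>\<psi>\<close>, so the main
    parts cancel.\<close>
  have "2 * (\<integral>x. f (W x) * atY c x * ?g1 x \<partial>M) + (\<integral>x. f' (W x) * atY c x * ?g2 x \<partial>M)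
      - lam * \<psi> * (\<integral>x. (f' (W x) - W x * f (W x)) * atY c x \<partial>M)
      = lam * (\<integral>x. f' (W x) * atY c x * R2 x \<partial>M) - 2 * lam * (\<integral>x. f (W x) * atY c x * R1 x \<partial>M)"
    unfolding e1 e2 e1' e2' V by (simp add: algebra_simps)
  with b1 b2 abs_triangle_ineq4[of "lam * (\<integral>x. f' (W x) * atY c x * R2 x \<partial>M)"
      "2 * lam * (\<integral>x. f (W x) * atY c x * R1 x \<partial>M)"]
  show "\<bar>2 * (\<integral>x. f (W x) * atY c x * ?g1 x \<partial>M) + (\<integral>x. f' (W x) * atY c x * ?g2 x \<partial>M)
      - lam * \<psi> * (\<integral>x. (f' (W x) - W x * f (W x)) * atY c x \<partial>M)\<bar>
      \<le> 2 * lam * (\<integral>x. \<bar>R1 x\<bar> * atY c x \<partial>M) + lam * s * (\<integral>x. \<bar>R2 x\<bar> * atY c x \<partial>M)"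
    by linarith
qed

lemma atY_step_le: "atY k x * step (-1) x + atY (k - 1) x * step 1 x \<le> atY k x + atY (k - 1) x"
  and atY_step_nonneg: "0 \<le> atY k x * step (-1) x + atY (k - 1) x * step 1 x"
  by (auto simp: atY_def step_def)

text \<open>Since \<open>d (f W + f W') = 2 d f W + d (f W' - f W)\<close> with
  \<open>d = W' - W\<close>, the terms on the left are the expansion of a quantity with mean zero,
  up to \<open>d\<close> times a Taylor remainder of size at most the square of
  \<open>d\<close>.\<close>

lemma crossing_taylor_bound:
  fixes f f' :: "real \<Rightarrow> real"
  assumes [measurable]: "f \<in> borel_measurable borel" "f' \<in> borel_measurable borel"
    and f: "\<And>w. \<bar>f w\<bar> \<le> 1" and f': "\<And>w. \<bar>f' w\<bar> \<le> s"
    and taylor: "\<And>v w. \<bar>f v - f w - (v - w) * f' w\<bar> \<le> (v - w)\<^sup>2"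
    and int3: "integrable M (\<lambda>x. \<bar>W' x - W x\<bar> ^ 3 * (atY k x + atY (k - 1) x))"
  shows "\<bar>2 * (\<integral>x. f (W x) * atY k x * ((W' x - W x) * step (-1) x) \<partial>M)
      + (\<integral>x. f' (W x) * atY k x * ((W' x - W x)\<^sup>2 * step (-1) x) \<partial>M)
      + (2 * (\<integral>x. f (W x) * atY (k - 1) x * ((W' x - W x) * step 1 x) \<partial>M)
      + (\<integral>x. f' (W x) * atY (k - 1) x * ((W' x - W x)\<^sup>2 * step 1 x) \<partial>M))\<bar>
      \<le> (\<integral>x. \<bar>W' x - W x\<bar> ^ 3 * (atY k x + atY (k - 1) x) \<partial>M)"
proof -
  let ?T = "\<lambda>x. atY k x * step (-1) x + atY (k - 1) x * step 1 x"
  let ?d = "\<lambda>x. W' x - W x"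
  \<comment> \<open>Swapping the pairs interchanges the two crossing events, so their sum is
    invariant and \<open>G\<close> changes sign only through \<open>w' - w\<close>.\<close>
  define G :: "real \<times> real \<times> real \<times> real \<Rightarrow> real" where
    "G = (\<lambda>(w, y, w', y'). (w' - w) * (f w + f w') *
      ((if y = k \<and> y' - y = -1 then 1 else 0) + (if y = k - 1 \<and> y' - y = 1 then 1 else 0)))"
  have [measurable]: "G \<in> borel_measurable borel"
    unfolding G_def borel_prod[symmetric] by measurable
  have G: "G (W x, Y x, W' x, Y' x) = ?d x * (f (W x) + f (W' x)) * ?T x" for x
    by (auto simp: G_def atY_def step_def)
  have G': "G (W' x, Y' x, W x, Y x) = - G (W x, Y x, W' x, Y' x)" for x
    by (auto simp: G_def algebra_simps)
  have zero: "(\<integral>x. ?d x * (f (W x) + f (W' x)) * ?T x \<partial>M) = 0"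
    using exchange_integral[of G] unfolding G' by (simp add: G)
  have Tm [measurable]: "?T \<in> borel_measurable M" by measurable
  have I: "integrable M (\<lambda>x. u x * atY c x * (g x * step j x))"
    if "integrable M g" "u \<in> borel_measurable M" "\<And>x. \<bar>u x\<bar> \<le> K" for u g c j K
  proof (rule integrable_bounded_mult[OF integrable_mult_step[OF that(1)]])
    show "(\<lambda>x. u x * atY c x) \<in> borel_measurable M" using that(2) by measurable
    show "\<bar>u x * atY c x\<bar> \<le> K" for x using that(3)[of x] by (auto simp: atY_def)
  qed
  have bf: "\<bar>f (W x)\<bar> \<le> 1" "\<bar>f' (W x)\<bar> \<le> s" "\<bar>f (W x) + f (W' x)\<bar> \<le> 2" for x
    using f[of "W x"] f'[of "W x"] f[of "W' x"] by auto
  have mf: "(\<lambda>x. f (W x)) \<in> borel_measurable M" "(\<lambda>x. f' (W x)) \<in> borel_measurable M"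
    "(\<lambda>x. f (W x) + f (W' x)) \<in> borel_measurable M"
    by measurable
  note J = I[OF integrable_diff mf(1) bf(1)] I[OF integrable_diff_square mf(2) bf(2)]
    I[OF integrable_diff mf(3) bf(3)]
  let ?S = "\<lambda>x. (2 * (f (W x) * atY k x * (?d x * step (-1) x))
      + f' (W x) * atY k x * ((?d x)\<^sup>2 * step (-1) x))
      + (2 * (f (W x) * atY (k - 1) x * (?d x * step 1 x))
      + f' (W x) * atY (k - 1) x * ((?d x)\<^sup>2 * step 1 x))"
  have intG: "integrable M (\<lambda>x. ?d x * (f (W x) + f (W' x)) * ?T x)"
    using Bochner_Integration.integrable_add[OF J(3)[of k "-1"] J(3)[of "k - 1" 1]]
    by (simp add: algebra_simps)
  have intS: "integrable M ?S"
    by (intro Bochner_Integration.integrable_add integrable_mult_right J)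
  have "\<bar>(\<integral>x. ?S x - ?d x * (f (W x) + f (W' x)) * ?T x \<partial>M)\<bar>
      \<le> (\<integral>x. \<bar>?d x\<bar> ^ 3 * (atY k x + atY (k - 1) x) \<partial>M)"
  proof (rule integral_abs_le_integral[OF Bochner_Integration.integrable_diff[OF intS intG] int3])
    fix x
    have "?S x - ?d x * (f (W x) + f (W' x)) * ?T x
        = - (?d x * (f (W' x) - f (W x) - ?d x * f' (W x)) * ?T x)"
      by (simp add: algebra_simps power2_eq_square)
    also have "\<bar>\<dots>\<bar> = \<bar>?d x\<bar> * \<bar>f (W' x) - f (W x) - ?d x * f' (W x)\<bar> * ?T x"
      using atY_step_nonneg[of k x] by (simp add: abs_mult)
    also have "\<dots> \<le> \<bar>?d x\<bar> * (?d x)\<^sup>2 * (atY k x + atY (k - 1) x)"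
      using atY_step_nonneg[of k x] atY_step_le[of k x] taylor[of "W' x" "W x"]
      by (intro mult_mono mult_left_mono) auto
    also have "\<bar>?d x\<bar> * (?d x)\<^sup>2 = \<bar>?d x\<bar> ^ 3"
      by (simp add: power3_eq_cube power2_eq_square mult.assoc)
    finally show "\<bar>?S x - ?d x * (f (W x) + f (W' x)) * ?T x\<bar> \<le> \<bar>?d x\<bar> ^ 3 * (atY k x + atY (k - 1) x)" .
  qed
  moreover have "(\<integral>x. ?S x - ?d x * (f (W x) + f (W' x)) * ?T x \<partial>M) = (\<integral>x. ?S x \<partial>M)"
    using Bochner_Integration.integral_diff[OF intS intG] zero by simp
  moreover have "(\<integral>x. ?S x \<partial>M) = 2 * (\<integral>x. f (W x) * atY k x * (?d x * step (-1) x) \<partial>M)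
      + (\<integral>x. f' (W x) * atY k x * ((?d x)\<^sup>2 * step (-1) x) \<partial>M)
      + (2 * (\<integral>x. f (W x) * atY (k - 1) x * (?d x * step 1 x) \<partial>M)
      + (\<integral>x. f' (W x) * atY (k - 1) x * ((?d x)\<^sup>2 * step 1 x) \<partial>M))"
    by (simp only: Bochner_Integration.integral_add Bochner_Integration.integrable_add
        integrable_mult_right J integral_mult_right_zero)
  ultimately show ?thesis by simp
qed

text \<open>A downward crossing from \<open>k\<close> has the same law as an upward crossing from
  \<open>k - 1\<close> with the roles of the pairs reversed. Both have conditional probability close
  to \<open>Q\<close>, so the two levels carry nearly equal integrals of \<open>H (W x)\<close>; the
  error consists of the zeroth-order remainders and the change from \<open>W\<close> to
  \<open>W'\<close>.\<close>

lemma crossing_balance_bound: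
  fixes H :: "real \<Rightarrow> real" and Rp Rm :: "'a \<Rightarrow> real"
  assumes [measurable]: "H \<in> borel_measurable borel" "Rp \<in> borel_measurable M" "Rm \<in> borel_measurable M"
    and H: "\<And>w. \<bar>H w\<bar> \<le> \<bar>w\<bar> + e" and Hl: "\<And>v w. \<bar>H v - H w\<bar> \<le> \<bar>v - w\<bar>"
    and Mp: "AE x in M. real_cond_exp M (sigma_pair M W Y) (step 1) x = Q + Rp x"
    and Mm: "AE x in M. real_cond_exp M (sigma_pair M W Y) (step (-1)) x = Q + Rm x"
  shows "integrable M (\<lambda>x. (\<bar>W x\<bar> + e) * (\<bar>Rp x\<bar> + \<bar>Rm x\<bar>))"
    and "\<bar>Q * (\<integral>x. H (W x) * atY k x \<partial>M) - Q * (\<integral>x. H (W x) * atY (k - 1) x \<partial>M)\<bar>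
      \<le> (\<integral>x. (\<bar>W x\<bar> + e) * (\<bar>Rp x\<bar> + \<bar>Rm x\<bar>) * (atY k x + atY (k - 1) x) \<partial>M)
        + (\<integral>x. \<bar>W' x - W x\<bar> * (atY k x + atY (k - 1) x) \<partial>M)"
proof -
  have e: "0 \<le> e" using H[of 0] by simp
  \<comment> \<open>Here the unbounded function \<open>\<bar>w\<bar> + e\<close> is the test
    function, so the remainder is integrable even with this weight.\<close>
  have intR: "integrable M (\<lambda>x. (\<bar>W x\<bar> + e) * R x)"
    if M: "AE x in M. real_cond_exp M (sigma_pair M W Y) (step j) x = Q + R x"
      and [measurable]: "R \<in> borel_measurable M" for R j
  proof -
    have "(\<lambda>z. \<bar>fst z\<bar> + e) \<in> borel_measurable (borel :: (real \<times> real) measure)"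
      unfolding borel_prod[symmetric] by measurable
    moreover have "integrable M (\<lambda>x. (\<bar>W x\<bar> + e) * step j x)"
      by (intro integrable_mult_step) (simp add: integrable_W)
    ultimately have "integrable M (\<lambda>x. (\<bar>W x\<bar> + e) * (Q + R x))"
      using integrable_cond_exp_pair[OF _ _ _ M, of "\<lambda>z. \<bar>fst z\<bar> + e"] by simp
    then have "integrable M (\<lambda>x. (\<bar>W x\<bar> + e) * (Q + R x) - Q * (\<bar>W x\<bar> + e))"
      using integrable_W by (intro Bochner_Integration.integrable_diff) auto
    then show ?thesis by (simp add: algebra_simps)
  qed
  have "integrable M (\<lambda>x. \<bar>(\<bar>W x\<bar> + e) * Rp x\<bar> + \<bar>(\<bar>W x\<bar> + e) * Rm x\<bar>)"
    by (intro Bochner_Integration.integrable_add integrable_abs intR[OF Mp] intR[OF Mm]) auto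
  then show intC: "integrable M (\<lambda>x. (\<bar>W x\<bar> + e) * (\<bar>Rp x\<bar> + \<bar>Rm x\<bar>))"
    using e by (simp add: abs_mult distrib_left)
  have HW: "integrable M (\<lambda>x. H (W x))"
  proof (rule Bochner_Integration.integrable_bound)
    show "integrable M (\<lambda>x. \<bar>W x\<bar> + e)" using integrable_W by simp
    show "AE x in M. norm (H (W x)) \<le> norm (\<bar>W x\<bar> + e)"
      using H e by simp
  qed simp
  have HD: "integrable M (\<lambda>x. H (W' x) - H (W x))"
  proof (rule Bochner_Integration.integrable_bound[OF integrable_diff])
    show "AE x in M. norm (H (W' x) - H (W x)) \<le> norm (W' x - W x)"
      using Hl by simp
  qed simp
  have HWa: "integrable M (\<lambda>x. H (W x) * atY c x)" for c
    using integrable_mult_atY[OF HW, of c] by (simp add: mult.commute)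
  have main: "(\<integral>x. H (W x) * atY c x * step j x \<partial>M) = Q * (\<integral>x. H (W x) * atY c x \<partial>M)
      + (\<integral>x. H (W x) * atY c x * R x \<partial>M)" "integrable M (\<lambda>x. H (W x) * atY c x * R x)"
    if M: "AE x in M. real_cond_exp M (sigma_pair M W Y) (step j) x = Q + R x"
      and [measurable]: "R \<in> borel_measurable M" for R j c
  proof -
    have u: "(\<lambda>z. H (fst z) * (if snd z = c then 1 else 0)) \<in> borel_measurable borel"
      unfolding borel_prod[symmetric] by measurable
    have i: "integrable M (\<lambda>x. H (W x) * (if Y x = c then 1 else 0) * step j x)"
      using integrable_mult_step[OF HWa[of c], of j] by (simp add: atY_def)
    have "integrable M (\<lambda>x. H (W x) * atY c x * (Q + R x))"
      using integrable_cond_exp_pair[OF u _ _ M] i by (simp add: atY_def)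
    then have "integrable M (\<lambda>x. H (W x) * atY c x * (Q + R x) - Q * (H (W x) * atY c x))"
      by (intro Bochner_Integration.integrable_diff integrable_mult_right HWa)
    then show iR: "integrable M (\<lambda>x. H (W x) * atY c x * R x)"
      by (simp add: algebra_simps)
    have "(\<integral>x. H (W x) * atY c x * step j x \<partial>M) = (\<integral>x. H (W x) * atY c x * (Q + R x) \<partial>M)"
      using integral_cond_exp_pair[OF u _ _ M] i by (simp add: atY_def)
    also have "\<dots> = (\<integral>x. Q * (H (W x) * atY c x) + H (W x) * atY c x * R x \<partial>M)"
      by (simp add: algebra_simps)
    also have "\<dots> = Q * (\<integral>x. H (W x) * atY c x \<partial>M) + (\<integral>x. H (W x) * atY c x * R x \<partial>M)"
      using HWa iR by (subst Bochner_Integration.integral_add) auto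
    finally show "(\<integral>x. H (W x) * atY c x * step j x \<partial>M) = Q * (\<integral>x. H (W x) * atY c x \<partial>M)
      + (\<integral>x. H (W x) * atY c x * R x \<partial>M)" .
  qed
  define G :: "real \<times> real \<times> real \<times> real \<Rightarrow> real" where
    "G = (\<lambda>(w, y, w', y'). H w * (if y = k \<and> y' - y = -1 then 1 else 0))"
  have [measurable]: "G \<in> borel_measurable borel"
    unfolding G_def borel_prod[symmetric] by measurable
  have G: "G (W x, Y x, W' x, Y' x) = H (W x) * atY k x * step (-1) x" for x
    by (auto simp: G_def atY_def step_def)
  \<comment> \<open>After the swap \<open>H\<close> is evaluated at \<open>W'\<close> while the
    level is that of \<open>Y\<close>; returning to \<open>H (W x)\<close> costs at most
    \<open>\<bar>W' x - W x\<bar>\<close>.\<close>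
  have G': "G (W' x, Y' x, W x, Y x) = H (W' x) * atY (k - 1) x * step 1 x" for x
    by (auto simp: G_def atY_def step_def)
  have swap: "(\<integral>x. H (W x) * atY k x * step (-1) x \<partial>M) = (\<integral>x. H (W' x) * atY (k - 1) x * step 1 x \<partial>M)"
    using exchange_integral[of G] unfolding G G' by simp
  have iD: "integrable M (\<lambda>x. (H (W' x) - H (W x)) * atY (k - 1) x * step 1 x)"
    using integrable_mult_step[OF integrable_mult_atY[OF HD, of "k - 1"], of 1] by (simp add: mult_ac)
  have "(\<integral>x. H (W' x) * atY (k - 1) x * step 1 x \<partial>M) =
      (\<integral>x. H (W x) * atY (k - 1) x * step 1 x + (H (W' x) - H (W x)) * atY (k - 1) x * step 1 x \<partial>M)"
    by (simp add: algebra_simps)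
  also have "\<dots> = (\<integral>x. H (W x) * atY (k - 1) x * step 1 x \<partial>M)
      + (\<integral>x. (H (W' x) - H (W x)) * atY (k - 1) x * step 1 x \<partial>M)"
    by (intro Bochner_Integration.integral_add integrable_mult_step HWa iD)
  finally have eq: "Q * (\<integral>x. H (W x) * atY k x \<partial>M) - Q * (\<integral>x. H (W x) * atY (k - 1) x \<partial>M) =
      ((\<integral>x. H (W x) * atY (k - 1) x * Rp x \<partial>M) - (\<integral>x. H (W x) * atY k x * Rm x \<partial>M))
      + (\<integral>x. (H (W' x) - H (W x)) * atY (k - 1) x * step 1 x \<partial>M)"
    using swap main(1)[OF Mp, of "k - 1"] main(1)[OF Mm, of k] by simp
  have iC: "integrable M (\<lambda>x. (\<bar>W x\<bar> + e) * (\<bar>Rp x\<bar> + \<bar>Rm x\<bar>) * (atY k x + atY (k - 1) x))"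
    using Bochner_Integration.integrable_add[OF integrable_mult_atY[OF intC, of k] integrable_mult_atY[OF intC, of "k - 1"]]
    by (simp add: algebra_simps)
  have iD': "integrable M (\<lambda>x. \<bar>W' x - W x\<bar> * (atY k x + atY (k - 1) x))"
    using Bochner_Integration.integrable_add[OF integrable_mult_atY[OF integrable_abs[OF integrable_diff], of k]
        integrable_mult_atY[OF integrable_abs[OF integrable_diff], of "k - 1"]]
    by (simp add: algebra_simps)
  have "\<bar>\<integral>x. H (W x) * atY (k - 1) x * Rp x - H (W x) * atY k x * Rm x \<partial>M\<bar>
      \<le> (\<integral>x. (\<bar>W x\<bar> + e) * (\<bar>Rp x\<bar> + \<bar>Rm x\<bar>) * (atY k x + atY (k - 1) x) \<partial>M)"
  proof (rule integral_abs_le_integral[OF Bochner_Integration.integrable_diff[OF main(2)[OF Mp] main(2)[OF Mm]] iC])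
    fix x
    have "\<bar>H (W x) * atY (k - 1) x * Rp x - H (W x) * atY k x * Rm x\<bar>
        = \<bar>H (W x)\<bar> * \<bar>atY (k - 1) x * Rp x - atY k x * Rm x\<bar>"
      unfolding abs_mult[symmetric] by (simp add: algebra_simps)
    also have "\<dots> \<le> (\<bar>W x\<bar> + e) * ((\<bar>Rp x\<bar> + \<bar>Rm x\<bar>) * (atY k x + atY (k - 1) x))"
      using H[of "W x"] e by (intro mult_mono) (auto simp: atY_def)
    finally show "\<bar>H (W x) * atY (k - 1) x * Rp x - H (W x) * atY k x * Rm x\<bar>
        \<le> (\<bar>W x\<bar> + e) * (\<bar>Rp x\<bar> + \<bar>Rm x\<bar>) * (atY k x + atY (k - 1) x)"
      by (simp add: mult.assoc)
  qed auto
  moreover have "\<bar>\<integral>x. (H (W' x) - H (W x)) * atY (k - 1) x * step 1 x \<partial>M\<bar>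
      \<le> (\<integral>x. \<bar>W' x - W x\<bar> * (atY k x + atY (k - 1) x) \<partial>M)"
  proof (rule integral_abs_le_integral[OF iD iD'])
    fix x
    show "\<bar>(H (W' x) - H (W x)) * atY (k - 1) x * step 1 x\<bar> \<le> \<bar>W' x - W x\<bar> * (atY k x + atY (k - 1) x)"
      using Hl[of "W' x" "W x"] by (auto simp: atY_def step_def)
  qed
  moreover have "(\<integral>x. H (W x) * atY (k - 1) x * Rp x - H (W x) * atY k x * Rm x \<partial>M) =
      (\<integral>x. H (W x) * atY (k - 1) x * Rp x \<partial>M) - (\<integral>x. H (W x) * atY k x * Rm x \<partial>M)"
    by (rule Bochner_Integration.integral_diff[OF main(2)[OF Mp] main(2)[OF Mm]]) auto
  ultimately show "\<bar>Q * (\<integral>x. H (W x) * atY k x \<partial>M) - Q * (\<integral>x. H (W x) * atY (k - 1) x \<partial>M)\<bar>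
      \<le> (\<integral>x. (\<bar>W x\<bar> + e) * (\<bar>Rp x\<bar> + \<bar>Rm x\<bar>) * (atY k x + atY (k - 1) x) \<partial>M)
        + (\<integral>x. \<bar>W' x - W x\<bar> * (atY k x + atY (k - 1) x) \<partial>M)"
    unfolding eq by linarith
qed

end

section \<open>The conditional bound\<close>

context exchangeable_pair
begin

text \<open>The estimate before division by the probability of the level \<open>k\<close>: half the
  bound on the sum over both levels plus half the bound on their difference.\<close>

lemma conditional_lipschitz_bound:
  fixes h :: "real \<Rightarrow> real" and R0p R0m R1p R1m R2p R2m :: "'a \<Rightarrow> real"
  assumes lip: "1-lipschitz_on UNIV h"
    and Rmeas [measurable]: "R0p \<in> borel_measurable M" "R0m \<in> borel_measurable M"
               "R1p \<in> borel_measurable M" "R1m \<in> borel_measurable M"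
               "R2p \<in> borel_measurable M" "R2m \<in> borel_measurable M"
    and lam: "0 < lam" and psi: "0 < \<psi>" and Q: "0 < Q"
    and M0p: "AE x in M. real_cond_exp M (sigma_pair M W Y) (step 1) x = Q + R0p x"
    and M0m: "AE x in M. real_cond_exp M (sigma_pair M W Y) (step (-1)) x = Q + R0m x"
    and M1p: "AE x in M. real_cond_exp M (sigma_pair M W Y)
          (\<lambda>x. (W' x - W x) * step 1 x) x = - lam * (\<psi> * W x / 2 + R1p x)"
    and M1m: "AE x in M. real_cond_exp M (sigma_pair M W Y)
          (\<lambda>x. (W' x - W x) * step (-1) x) x = - lam * (\<psi> * W x / 2 + R1m x)"
    and M2p: "AE x in M. real_cond_exp M (sigma_pair M W Y)
          (\<lambda>x. (W' x - W x)\<^sup>2 * step 1 x) x = lam * (\<psi> + R2p x)"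
    and M2m: "AE x in M. real_cond_exp M (sigma_pair M W Y)
          (\<lambda>x. (W' x - W x)\<^sup>2 * step (-1) x) x = lam * (\<psi> + R2m x)"
    and int3: "integrable M (\<lambda>x. \<bar>W' x - W x\<bar> ^ 3 * (atY k x + atY (k - 1) x))"
  shows "\<bar>\<integral>x. (h (W x) - std_normal_exp h) * atY k x \<partial>M\<bar> \<le>
      1 / \<psi> * ((\<integral>x. \<bar>R1m x\<bar> * atY k x \<partial>M) + (\<integral>x. \<bar>R1p x\<bar> * atY (k - 1) x \<partial>M))
      + sqrt (2 / pi) / (2 * \<psi>) * ((\<integral>x. \<bar>R2m x\<bar> * atY k x \<partial>M) + (\<integral>x. \<bar>R2p x\<bar> * atY (k - 1) x \<partial>M))
      + 1 / (2 * Q) * ((\<integral>x. (\<bar>W x\<bar> + std_normal_exp abs) * (\<bar>R0p x\<bar> + \<bar>R0m x\<bar>) * (atY k x + atY (k - 1) x) \<partial>M)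
        + (\<integral>x. \<bar>W' x - W x\<bar> * (atY k x + atY (k - 1) x) \<partial>M))
      + 1 / (2 * lam * \<psi>) * (\<integral>x. \<bar>W' x - W x\<bar> ^ 3 * (atY k x + atY (k - 1) x) \<partial>M)"
proof -
  obtain f f' where Df: "\<And>w. (f has_real_derivative f' w) (at w)"
    and stein: "\<And>w. f' w - w * f w = h w - std_normal_exp h"
    and f: "\<And>w. \<bar>f w\<bar> \<le> 1" and f': "\<And>w. \<bar>f' w\<bar> \<le> sqrt (2 / pi)"
    and lip': "\<And>v w. \<bar>f' v - f' w\<bar> \<le> 2 * \<bar>v - w\<bar>"
    using stein_solution[OF lip] by blast
  have mh [measurable]: "h \<in> borel_measurable borel"
    using borel_measurable_continuous_onI lipschitz_on_continuous_on[OF lip] by blast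
  have "continuous_on UNIV f"
    using Df DERIV_isCont continuous_at_imp_continuous_on by blast
  then have mf [measurable]: "f \<in> borel_measurable borel"
    by (rule borel_measurable_continuous_onI)
  have "f' = (\<lambda>w. w * f w + (h w - std_normal_exp h))"
    using stein by (auto simp: fun_eq_iff algebra_simps)
  then have mf' [measurable]: "f' \<in> borel_measurable borel"
    by simp
  define X where "X c = (\<integral>x. (h (W x) - std_normal_exp h) * atY c x \<partial>M)" for c
  \<comment> \<open>Stein's equation makes the main term \<open>lam * \<psi> * X c\<close>. The
    downward step is used at level \<open>k\<close> and the upward step at \<open>k - 1\<close>, the
    two directions counted in \<open>cross\<close>.\<close>
  note side = one_sided_stein_identity(3)[OF mf mf' _ _ f f' lam, unfolded stein, folded X_def]
  note m = side[OF Rmeas(4,6) M1m M2m, of k] and p = side[OF Rmeas(3,5) M1p M2p, of "k - 1"]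
  note cross = crossing_taylor_bound[OF mf mf' f f' taylor_lipschitz_deriv[OF Df lip'] int3]
  define A where "A = (\<integral>x. \<bar>R1m x\<bar> * atY k x \<partial>M) + (\<integral>x. \<bar>R1p x\<bar> * atY (k - 1) x \<partial>M)"
  define B where "B = (\<integral>x. \<bar>R2m x\<bar> * atY k x \<partial>M) + (\<integral>x. \<bar>R2p x\<bar> * atY (k - 1) x \<partial>M)"
  define E where "E = (\<integral>x. \<bar>W' x - W x\<bar> ^ 3 * (atY k x + atY (k - 1) x) \<partial>M)"
  define CD where "CD = (\<integral>x. (\<bar>W x\<bar> + std_normal_exp abs) * (\<bar>R0p x\<bar> + \<bar>R0m x\<bar>) * (atY k x + atY (k - 1) x) \<partial>M)
        + (\<integral>x. \<bar>W' x - W x\<bar> * (atY k x + atY (k - 1) x) \<partial>M)"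
  have "\<bar>lam * \<psi> * X k + lam * \<psi> * X (k - 1)\<bar> \<le> 2 * lam * A + lam * sqrt (2 / pi) * B + E"
  proof -
    have arith: "\<bar>x + y\<bar> \<le> a + b + e" if "\<bar>u - x\<bar> \<le> a" "\<bar>v - y\<bar> \<le> b" "\<bar>u + v\<bar> \<le> e"
      for u v x y a b e :: real
      using that by linarith
    show ?thesis
      using arith[OF m p cross] by (simp add: A_def B_def E_def algebra_simps)
  qed
  then have "lam * \<psi> * \<bar>X k + X (k - 1)\<bar> \<le> 2 * lam * A + lam * sqrt (2 / pi) * B + E"
    using lam psi unfolding distrib_left[symmetric] by (simp add: abs_mult)
  then have "\<bar>X k + X (k - 1)\<bar> \<le> (2 * lam * A + lam * sqrt (2 / pi) * B + E) / (lam * \<psi>)"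
    using lam psi by (simp add: pos_le_divide_eq mult.commute)
  also have "\<dots> = 2 / \<psi> * A + sqrt (2 / pi) / \<psi> * B + E / (lam * \<psi>)"
    using lam by (simp add: add_divide_distrib)
  finally have sum: "\<bar>X k + X (k - 1)\<bar> \<le> 2 / \<psi> * A + sqrt (2 / pi) / \<psi> * B + E / (lam * \<psi>)" .
  have "\<bar>Q * X k - Q * X (k - 1)\<bar> \<le> CD"
    unfolding CD_def X_def
  proof (rule crossing_balance_bound(2)[OF _ _ _ _ _ M0p M0m, of "\<lambda>w. h w - std_normal_exp h"])
    show "\<bar>h w - std_normal_exp h\<bar> \<le> \<bar>w\<bar> + std_normal_exp abs" for w
      by (rule lipschitz_minus_std_normal_exp_le[OF lip])
    show "\<bar>h v - std_normal_exp h - (h w - std_normal_exp h)\<bar> \<le> \<bar>v - w\<bar>" for v w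
      using lipschitz_abs_le[OF lip, of v w] by simp
  qed auto
  then have "Q * \<bar>X k - X (k - 1)\<bar> \<le> CD"
    using Q unfolding right_diff_distrib[symmetric] by (simp add: abs_mult)
  then have diff: "\<bar>X k - X (k - 1)\<bar> \<le> CD / Q"
    using Q by (simp add: pos_le_divide_eq mult.commute)
  have "\<bar>X k\<bar> \<le> (2 / \<psi> * A + sqrt (2 / pi) / \<psi> * B + E / (lam * \<psi>) + CD / Q) / 2"
  proof -
    have "\<bar>x\<bar> \<le> (a + b) / 2" if "\<bar>x + y\<bar> \<le> a" "\<bar>x - y\<bar> \<le> b" for x y a b :: real
      using that unfolding abs_le_iff by auto
    from this[OF sum diff] show ?thesis .
  qed
  also have "\<dots> = 1 / \<psi> * A + sqrt (2 / pi) / (2 * \<psi>) * B + 1 / (2 * Q) * CD + 1 / (2 * lam * \<psi>) * E"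
    by (simp add: add_divide_distrib)
  finally show ?thesis
    unfolding A_def B_def CD_def E_def X_def .
qed

end

section \<open>Conditional expectations as extended reals\<close>

lemma cond_nn_eq:
  assumes "finite_measure M" "integrable M (\<lambda>x. f x * indicator B x)" "\<And>x. 0 \<le> f x" "0 < measure M B"
  shows "cond_nn M f B = ennreal ((\<integral>x. f x * indicator B x \<partial>M) / measure M B)"
proof -
  interpret finite_measure M by fact
  have "(\<integral>\<^sup>+x. ennreal (f x) * indicator B x \<partial>M) = (\<integral>\<^sup>+x. ennreal (f x * indicator B x) \<partial>M)"
    by (intro nn_integral_cong) (auto simp: indicator_def)
  also have "\<dots> = ennreal (\<integral>x. f x * indicator B x \<partial>M)"
    using assms by (intro nn_integral_eq_integral) (auto simp: indicator_def)
  finally show ?thesis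
    unfolding cond_nn_def emeasure_eq_measure using assms
    by (simp add: divide_ennreal integral_nonneg_AE)
qed

text \<open>Covers an infinite third moment, for which the claimed bound becomes trivial.\<close>

lemma cond_nn_eq_top:
  assumes "finite_measure M" "f \<in> borel_measurable M" "B \<in> sets M" "\<And>x. 0 \<le> f x"
    and "\<not> integrable M (\<lambda>x. f x * indicator B x)"
  shows "cond_nn M f B = \<top>"
proof -
  interpret finite_measure M by fact
  have "(\<integral>\<^sup>+x. ennreal (f x) * indicator B x \<partial>M) = (\<integral>\<^sup>+x. ennreal (f x * indicator B x) \<partial>M)"
    by (intro nn_integral_cong) (auto simp: indicator_def)
  moreover have "(\<integral>\<^sup>+x. ennreal (f x * indicator B x) \<partial>M) = \<top>"
  proof (rule ccontr)
    assume "(\<integral>\<^sup>+x. ennreal (f x * indicator B x) \<partial>M) \<noteq> \<top>"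
    then have "integrable M (\<lambda>x. f x * indicator B x)"
      using assms by (intro integrableI_nonneg) (auto simp: indicator_def top.not_eq_extremum)
    with assms show False by simp
  qed
  ultimately show ?thesis
    unfolding cond_nn_def by (simp add: emeasure_eq_measure ennreal_top_divide)
qed

lemma ennreal_bound_assembly:
  fixes a1 a2 b1 b2 c d e r x y z t :: real
  assumes "0 \<le> a1" "0 \<le> a2" "0 \<le> b1" "0 \<le> b2" "0 \<le> c" "0 \<le> d" "0 \<le> e"
    and "0 \<le> r" "0 \<le> x" "0 \<le> y" "0 \<le> z" "0 \<le> t"
  shows "ennreal x * (ennreal a1 + ennreal r * ennreal a2) + ennreal y * (ennreal b1 + ennreal r * ennreal b2)
      + ennreal (1 + r) * (ennreal z * ennreal c + ennreal z * ennreal d + ennreal t * ennreal e)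
    = ennreal (x * (a1 + r * a2) + y * (b1 + r * b2) + (1 + r) * (z * c + z * d + t * e))"
  using assms by (simp add: ennreal_mult[symmetric] ennreal_plus[symmetric] del: ennreal_plus)

text \<open>Zero variance would make \<open>Y\<close> almost surely constant, which excludes a
  second atom. With the atoms \<open>k\<close> and \<open>k - 1\<close> this makes \<open>Q\<close>
  positive, so that division by \<open>Q\<close> is legitimate.\<close>

lemma (in prob_space) variance_pos_of_two_atoms:
  fixes Y :: "'a \<Rightarrow> real"
  assumes [measurable]: "Y \<in> borel_measurable M" and "integrable M (\<lambda>x. (Y x)\<^sup>2)"
    and "a \<noteq> b" "0 < prob {x \<in> space M. Y x = a}" "0 < prob {x \<in> space M. Y x = b}"
  shows "0 < variance Y"
proof (rule ccontr)
  assume "\<not> 0 < variance Y"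
  then have zero: "variance Y = 0"
    using variance_positive[of Y] by simp
  have "integrable M Y"
    by (rule square_integrable_imp_integrable) (use assms in auto)
  then have "integrable M (\<lambda>x. (Y x - expectation Y)\<^sup>2)"
    using assms by (simp add: power2_diff)
  then have AE: "AE x in M. Y x = expectation Y"
    using zero by (subst (asm) integral_nonneg_eq_0_iff_AE) auto
  have "c = expectation Y" if "0 < prob {x \<in> space M. Y x = c}" for c
  proof (rule ccontr)
    assume "c \<noteq> expectation Y"
    then have "AE x in M. \<not> Y x = c"
      using AE by auto
    then have "prob {x \<in> space M. Y x = c} = 0"
      by (subst prob_eq_0) auto
    with that show False by simp
  qed
  then show False using assms by metis
qed

theorem theorem2p4:
  fixes M :: "'a measure" and W Y W' Y' :: "'a \<Rightarrow> real"
    and R0p R0m R1p R1m R2p R2m :: "'a \<Rightarrow> real"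
    and \<zeta> lam \<psi> Q k :: real
  assumes M: "prob_space M"
    and meas: "W \<in> borel_measurable M" "Y \<in> borel_measurable M"
              "W' \<in> borel_measurable M" "Y' \<in> borel_measurable M"
    and Wsq: "integrable M (\<lambda>x. (W x)\<^sup>2)" and Ysq: "integrable M (\<lambda>x. (Y x)\<^sup>2)"
    and EW: "prob_space.expectation M W = 0" and VarW: "prob_space.variance M W = 1"
    and EY: "prob_space.expectation M Y = 0"
    and uncorr: "prob_space.expectation M (\<lambda>x. (W x - prob_space.expectation M W) *
                    (Y x - prob_space.expectation M Y)) = 0"
    and exch: "distr M borel (\<lambda>x. (W x, Y x, W' x, Y' x)) = distr M borel (\<lambda>x. (W' x, Y' x, W x, Y x))"
    and zeta: "0 \<le> \<zeta>" "\<zeta> < 1" and lattice: "AE x in M. Y x - \<zeta> \<in> \<int>"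
    and dY: "AE x in M. Y' x - Y x \<in> {-1, 0, 1}"
    and lam: "0 < lam" "lam < 1" and Qdef: "Q = lam * prob_space.variance M Y"
    and psi: "\<psi> > 0"
    and Rmeas: "R0p \<in> borel_measurable M" "R0m \<in> borel_measurable M"
               "R1p \<in> borel_measurable M" "R1m \<in> borel_measurable M"
               "R2p \<in> borel_measurable M" "R2m \<in> borel_measurable M"
    and M0p: "AE x in M. real_cond_exp M (sigma_pair M W Y)
                (\<lambda>x. if Y' x - Y x = 1 then 1 else 0) x = Q + R0p x"
    and M0m: "AE x in M. real_cond_exp M (sigma_pair M W Y)
                (\<lambda>x. if Y' x - Y x = -1 then 1 else 0) x = Q + R0m x"
    and M1p: "AE x in M. real_cond_exp M (sigma_pair M W Y)
                (\<lambda>x. (W' x - W x) * (if Y' x - Y x = 1 then 1 else 0)) x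
                = - lam * (\<psi> * W x / 2 + R1p x)"
    and M1m: "AE x in M. real_cond_exp M (sigma_pair M W Y)
                (\<lambda>x. (W' x - W x) * (if Y' x - Y x = -1 then 1 else 0)) x
                = - lam * (\<psi> * W x / 2 + R1m x)"
    and M2p: "AE x in M. real_cond_exp M (sigma_pair M W Y)
                (\<lambda>x. (W' x - W x)\<^sup>2 * (if Y' x - Y x = 1 then 1 else 0)) x
                = lam * (\<psi> + R2p x)"
    and M2m: "AE x in M. real_cond_exp M (sigma_pair M W Y)
                (\<lambda>x. (W' x - W x)\<^sup>2 * (if Y' x - Y x = -1 then 1 else 0)) x
                = lam * (\<psi> + R2m x)"
    and pk: "measure M {x \<in> space M. Y x = k} > 0"
    and pk1: "measure M {x \<in> space M. Y x = k - 1} > 0"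
  shows
    "let Bk = {x \<in> space M. Y x = k};
         Bk1 = {x \<in> space M. Y x = k - 1};
         Bboth = {x \<in> space M. Y x \<in> {k - 1, k}};
         r = measure M Bk1 / measure M Bk;
         EabsZ = std_normal_exp abs;
         A = cond_nn M (\<lambda>x. \<bar>R1m x\<bar>) Bk + ennreal r * cond_nn M (\<lambda>x. \<bar>R1p x\<bar>) Bk1;
         B = cond_nn M (\<lambda>x. \<bar>R2m x\<bar>) Bk + ennreal r * cond_nn M (\<lambda>x. \<bar>R2p x\<bar>) Bk1;
         C = cond_nn M (\<lambda>x. (\<bar>W x\<bar> + EabsZ) * (\<bar>R0p x\<bar> + \<bar>R0m x\<bar>)) Bboth;
         D = cond_nn M (\<lambda>x. \<bar>W' x - W x\<bar>) Bboth;
         E = cond_nn M (\<lambda>x. \<bar>W' x - W x\<bar> ^ 3) Bboth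
     in dW_cond M W Bk
        \<le> ennreal (1 / \<psi>) * A + ennreal (sqrt (1 / (2 * pi * \<psi>\<^sup>2))) * B
          + ennreal (1 + r) * (ennreal (1 / (2 * Q)) * C + ennreal (1 / (2 * Q)) * D
                               + ennreal (2 / (3 * lam * \<psi>)) * E)"
proof -
  interpret exchangeable_pair M W Y W' Y'
    using M meas Wsq exch by (simp add: exchangeable_pair_def exchangeable_pair_axioms_def)
  let ?Bk = "{x \<in> space M. Y x = k}" and ?Bk1 = "{x \<in> space M. Y x = k - 1}"
    and ?B = "{x \<in> space M. Y x \<in> {k - 1, k}}"
  define p where "p = measure M ?Bk"
  define p1 where "p1 = measure M ?Bk1"
  define r where "r = p1 / p"
  define e where "e = std_normal_exp abs"
  have p: "0 < p" "0 < p1" and r: "0 \<le> r"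
    using pk pk1 by (simp_all add: p_def p1_def r_def)
  have Q: "0 < Q"
    using variance_pos_of_two_atoms[OF meas(2) Ysq, of k "k - 1"] pk pk1 lam
    by (simp add: Qdef)
  have fm: "finite_measure M" by unfold_locales
  have sets [measurable]: "?Bk \<in> sets M" "?Bk1 \<in> sets M" "?B \<in> sets M"
    by measurable
  have pB: "measure M ?B = p + p1"
  proof -
    have "?B = ?Bk \<union> ?Bk1" by auto
    then show ?thesis
      unfolding p_def p1_def by (simp add: finite_measure_Union[OF sets(1,2)] disjoint_iff)
  qed
  have ind: "indicator ?Bk x = atY k x" "indicator ?Bk1 x = atY (k - 1) x"
    "indicator ?B x = atY k x + atY (k - 1) x" if "x \<in> space M" for x
    using that by (auto simp: atY_def indicator_def)
  have e: "0 \<le> e"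
    unfolding e_def std_normal_exp_def by (rule Bochner_Integration.integral_nonneg) simp
  note step_eq = step_def[symmetric]
  have M0: "AE x in M. real_cond_exp M (sigma_pair M W Y) (step 1) x = Q + R0p x"
    "AE x in M. real_cond_exp M (sigma_pair M W Y) (step (-1)) x = Q + R0m x"
    using M0p M0m unfolding step_def[abs_def] .
  note M1 = M1p[unfolded step_eq] M1m[unfolded step_eq] and M2 = M2p[unfolded step_eq] M2m[unfolded step_eq]
  define E where "E = cond_nn M (\<lambda>x. \<bar>W' x - W x\<bar> ^ 3) ?B"
  define rest where "rest = ennreal (1 / \<psi>) * (cond_nn M (\<lambda>x. \<bar>R1m x\<bar>) ?Bk + ennreal r * cond_nn M (\<lambda>x. \<bar>R1p x\<bar>) ?Bk1)
      + ennreal (sqrt (1 / (2 * pi * \<psi>\<^sup>2))) * (cond_nn M (\<lambda>x. \<bar>R2m x\<bar>) ?Bk + ennreal r * cond_nn M (\<lambda>x. \<bar>R2p x\<bar>) ?Bk1)"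
  define CD where "CD = ennreal (1 / (2 * Q)) * cond_nn M (\<lambda>x. (\<bar>W x\<bar> + e) * (\<bar>R0p x\<bar> + \<bar>R0m x\<bar>)) ?B
      + ennreal (1 / (2 * Q)) * cond_nn M (\<lambda>x. \<bar>W' x - W x\<bar>) ?B"
  have "dW_cond M W ?Bk \<le> rest + ennreal (1 + r) * (CD + ennreal (2 / (3 * lam * \<psi>)) * E)"
  \<comment> \<open>If the third moment is infinite, its positive coefficients make the right-hand
    side \<open>\<top>\<close>. Otherwise every term is finite and the estimate is one between
    reals.\<close>
  proof (cases "integrable M (\<lambda>x. \<bar>W' x - W x\<bar> ^ 3 * indicator ?B x)")
    case False
    then have "E = \<top>"
      unfolding E_def by (intro cond_nn_eq_top fm) auto
    moreover have "ennreal (2 / (3 * lam * \<psi>)) \<noteq> 0" "ennreal (1 + r) \<noteq> 0"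
      using lam psi r by auto
    ultimately show ?thesis
      by (simp add: ennreal_mult_top)
  next
    case True
    have cong: "integrable M (\<lambda>x. g x * indicator ?B x) \<longleftrightarrow> integrable M (\<lambda>x. g x * (atY k x + atY (k - 1) x))"
      "(\<integral>x. g x * indicator ?B x \<partial>M) = (\<integral>x. g x * (atY k x + atY (k - 1) x) \<partial>M)"
      "(\<integral>x. g x * indicator ?Bk x \<partial>M) = (\<integral>x. g x * atY k x \<partial>M)"
      "(\<integral>x. g x * indicator ?Bk1 x \<partial>M) = (\<integral>x. g x * atY (k - 1) x \<partial>M)" for g :: "'a \<Rightarrow> real"
      by (intro Bochner_Integration.integrable_cong Bochner_Integration.integral_cong refl; simp only: ind)+
    have conv: "cond_nn M g S = ennreal ((\<integral>x. g x * indicator S x \<partial>M) / measure M S)"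
      if "integrable M g" "\<And>x. 0 \<le> g x" "0 < measure M S" "S \<in> sets M" for g S
      using that integrable_real_mult_indicator[of S M g] by (intro cond_nn_eq fm) auto
    \<comment> \<open>The zero functions are dummies: only the integrability of the remainders is
      extracted here, and likewise with \<open>H = 0\<close> for \<open>intC\<close>.\<close>
    note side = one_sided_stein_identity(1,2)[of "\<lambda>_. 0" "\<lambda>_. 0", OF _ _ _ _ _ _ lam(1)]
    have intR: "integrable M R1m" "integrable M R1p" "integrable M R2m" "integrable M R2p"
      using side[OF _ _ _ _ _ _ M1(2) M2(2), of 0] side[OF _ _ _ _ _ _ M1(1) M2(1), of 0] Rmeas by simp_all
    have intC: "integrable M (\<lambda>x. (\<bar>W x\<bar> + e) * (\<bar>R0p x\<bar> + \<bar>R0m x\<bar>))"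
      by (rule crossing_balance_bound(1)[OF _ Rmeas(1,2) _ _ M0, of "\<lambda>_. 0"]) (use e in auto)
    define A1 where "A1 = (\<integral>x. \<bar>R1m x\<bar> * atY k x \<partial>M)"
    define A2 where "A2 = (\<integral>x. \<bar>R1p x\<bar> * atY (k - 1) x \<partial>M)"
    define B1 where "B1 = (\<integral>x. \<bar>R2m x\<bar> * atY k x \<partial>M)"
    define B2 where "B2 = (\<integral>x. \<bar>R2p x\<bar> * atY (k - 1) x \<partial>M)"
    define C where "C = (\<integral>x. (\<bar>W x\<bar> + e) * (\<bar>R0p x\<bar> + \<bar>R0m x\<bar>) * (atY k x + atY (k - 1) x) \<partial>M)"
    define D where "D = (\<integral>x. \<bar>W' x - W x\<bar> * (atY k x + atY (k - 1) x) \<partial>M)"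
    define F where "F = (\<integral>x. \<bar>W' x - W x\<bar> ^ 3 * (atY k x + atY (k - 1) x) \<partial>M)"
    have nonneg: "0 \<le> A1" "0 \<le> A2" "0 \<le> B1" "0 \<le> B2" "0 \<le> C" "0 \<le> D" "0 \<le> F"
      unfolding A1_def A2_def B1_def B2_def C_def D_def F_def
      by (intro Bochner_Integration.integral_nonneg mult_nonneg_nonneg add_nonneg_nonneg atY_nonneg e; simp)+
    have cA: "cond_nn M (\<lambda>x. \<bar>R1m x\<bar>) ?Bk = ennreal (A1 / p)" "cond_nn M (\<lambda>x. \<bar>R1p x\<bar>) ?Bk1 = ennreal (A2 / p1)"
      and cB: "cond_nn M (\<lambda>x. \<bar>R2m x\<bar>) ?Bk = ennreal (B1 / p)" "cond_nn M (\<lambda>x. \<bar>R2p x\<bar>) ?Bk1 = ennreal (B2 / p1)"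
      using intR pk pk1
      by (subst conv; simp add: cong A1_def A2_def B1_def B2_def p_def p1_def)+
    have cC: "cond_nn M (\<lambda>x. (\<bar>W x\<bar> + e) * (\<bar>R0p x\<bar> + \<bar>R0m x\<bar>)) ?B = ennreal (C / (p + p1))"
      unfolding C_def cong(2)[symmetric] pB[symmetric]
      by (rule conv) (use intC pB p e in auto)
    have cD: "cond_nn M (\<lambda>x. \<bar>W' x - W x\<bar>) ?B = ennreal (D / (p + p1))"
      unfolding D_def cong(2)[symmetric] pB[symmetric]
      by (rule conv) (use integrable_diff pB p in auto)
    have cE: "E = ennreal (F / (p + p1))"
      unfolding E_def F_def cong(2)[symmetric] pB[symmetric]
      by (rule cond_nn_eq[OF fm True]) (use pB p in auto)
    have "dW_cond M W ?Bk \<le> ennreal (1 / \<psi> * (A1 / p + r * (A2 / p1))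
        + sqrt (1 / (2 * pi * \<psi>\<^sup>2)) * (B1 / p + r * (B2 / p1))
        + (1 + r) * (1 / (2 * Q) * (C / (p + p1)) + 1 / (2 * Q) * (D / (p + p1))
          + 2 / (3 * lam * \<psi>) * (F / (p + p1))))" (is "_ \<le> ennreal ?bound")
      unfolding dW_cond_def
    proof (rule SUP_least)
      fix h :: "real \<Rightarrow> real" assume "h \<in> {h. 1-lipschitz_on UNIV h}"
      then have lip: "1-lipschitz_on UNIV h" by simp
      let ?X = "\<integral>x. (h (W x) - std_normal_exp h) * atY k x \<partial>M"
      have "h \<in> borel_measurable borel"
        using borel_measurable_continuous_onI lipschitz_on_continuous_on[OF lip] by blast
      then have [measurable]: "(\<lambda>x. h (W x)) \<in> borel_measurable M" by measurable
      have hW: "integrable M (\<lambda>x. h (W x))"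
      proof (rule Bochner_Integration.integrable_bound)
        show "integrable M (\<lambda>x. \<bar>h 0\<bar> + \<bar>W x\<bar>)"
          using integrable_W by simp
        have "\<bar>h (W x)\<bar> \<le> \<bar>h 0\<bar> + \<bar>W x\<bar>" for x
          using lipschitz_abs_le[OF lip, of "W x" 0] by simp
        then show "AE x in M. norm (h (W x)) \<le> norm (\<bar>h 0\<bar> + \<bar>W x\<bar>)"
          by simp
      qed simp
      have "?X = (\<integral>x. h (W x) * atY k x - std_normal_exp h * atY k x \<partial>M)"
        by (simp add: left_diff_distrib)
      also have "\<dots> = (\<integral>x. h (W x) * atY k x \<partial>M) - std_normal_exp h * (\<integral>x. 1 * atY k x \<partial>M)"
        using integrable_mult_atY[OF hW, of k] integrable_mult_atY[of "\<lambda>_. 1" k]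
        by (subst Bochner_Integration.integral_diff) (auto simp: mult.commute)
      also have "(\<integral>x. 1 * atY k x \<partial>M) = p"
        unfolding cong(3)[symmetric] p_def by simp
      finally have "cond_ev M (\<lambda>x. h (W x)) ?Bk - std_normal_exp h = ?X / p"
        unfolding cond_ev_def cong p_def[symmetric] using p by (simp add: field_simps)
      then have "\<bar>cond_ev M (\<lambda>x. h (W x)) ?Bk - std_normal_exp h\<bar> = \<bar>?X\<bar> / p"
        using p by simp
      also have "\<dots> \<le> (1 / \<psi> * (A1 + A2) + sqrt (2 / pi) / (2 * \<psi>) * (B1 + B2)
          + 1 / (2 * Q) * (C + D) + 1 / (2 * lam * \<psi>) * F) / p"
        unfolding A1_def A2_def B1_def B2_def C_def D_def F_def e_def using p
        by (intro divide_right_mono conditional_lipschitz_bound lip Rmeas lam psi Q M0 M1 M2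
            True[unfolded cong]) simp
      \<comment> \<open>The quadratic Taylor remainder yields the coefficient
        \<open>1 / (2 * lam * \<psi>)\<close> for the third moment; it is enlarged to the stated
        \<open>2 / (3 * lam * \<psi>)\<close>.\<close>
      also have "\<dots> \<le> (1 / \<psi> * (A1 + A2) + sqrt (2 / pi) / (2 * \<psi>) * (B1 + B2)
          + 1 / (2 * Q) * (C + D) + 2 / (3 * lam * \<psi>) * F) / p"
        using p nonneg(7) lam psi
        by (intro divide_right_mono add_left_mono mult_right_mono) (auto simp: field_simps)
      also have "\<dots> = ?bound"
      proof -
        have sq: "sqrt (1 / (2 * pi * \<psi>\<^sup>2)) = sqrt (2 / pi) / (2 * \<psi>)"
          using psi by (intro real_sqrt_unique) (auto simp: power_divide power_mult_distrib)
        \<comment> \<open>The factors \<open>r\<close> and \<open>1 + r\<close> only renormalise: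
          they turn means conditioned on the level \<open>k - 1\<close>, or on both levels, into
          integrals divided by \<open>p\<close>.\<close>
        have r1: "r * (t / p1) = t / p" "(1 + r) * (t / (p + p1)) = t / p" for t
        proof -
          have "1 + r = (p + p1) / p"
            using p by (simp add: r_def add_divide_distrib)
          with p show "r * (t / p1) = t / p" "(1 + r) * (t / (p + p1)) = t / p"
            by (simp_all add: r_def)
        qed
        have "?bound = 1 / \<psi> * (A1 / p + r * (A2 / p1)) + sqrt (1 / (2 * pi * \<psi>\<^sup>2)) * (B1 / p + r * (B2 / p1))
            + (1 / (2 * Q) * ((1 + r) * (C / (p + p1))) + 1 / (2 * Q) * ((1 + r) * (D / (p + p1)))
              + 2 / (3 * lam * \<psi>) * ((1 + r) * (F / (p + p1))))"
          by (simp only: distrib_left mult.left_commute)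
        also have "\<dots> = 1 / \<psi> * (A1 / p + A2 / p) + sqrt (2 / pi) / (2 * \<psi>) * (B1 / p + B2 / p)
            + (1 / (2 * Q) * (C / p) + 1 / (2 * Q) * (D / p) + 2 / (3 * lam * \<psi>) * (F / p))"
          unfolding r1 sq ..
        finally show ?thesis
          by (simp add: add_divide_distrib distrib_left)
      qed
      finally show "ennreal \<bar>cond_ev M (\<lambda>x. h (W x)) ?Bk - std_normal_exp h\<bar> \<le> ennreal ?bound"
        by (rule ennreal_leI)
    qed
    also have "\<dots> = rest + ennreal (1 + r) * (CD + ennreal (2 / (3 * lam * \<psi>)) * E)"
      unfolding rest_def CD_def cA cB cC cD cE using nonneg p r lam psi Q
      by (subst ennreal_bound_assembly) auto
    finally show ?thesis .
  qed
  then show ?thesis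
    unfolding Let_def rest_def CD_def E_def e_def r_def p_def p1_def .
qed

end
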